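(* Let $\mathbb{E}$ be a Gumm category and $Y_{\bullet}$ an internal category in $\mathbb{E}$. Then the category $Difib_{Y_{\bullet}}$ of discrete fibrations above $Y_{\bullet}$ is a Gumm category. Dually, the category $Dicofib_{Y_{\bullet}}$ of discrete cofibrations above $Y_{\bullet}$ is a Gumm category.
   Context: A Gumm category is a finitely complete category satisfying the Shifting Lemma: for any equivalence relations $R,S,T$ on an object $X$ with $R\cap S\subset T$ and any generalized elements $x,y,x',y'$ of $X$ with $xSy$, $x'Sy'$, $xRx'$, $yRy'$, if $xTx'$ then $yTy'$. For an internal category $X_\bullet$, $d_0,d_1:X_1\to X_0$ denote the domain and codomain maps. An internal functor $h_\bullet:X_\bullet\to Y_\bullet$ is a discrete fibration (resp. discrete cofibration) when the commutative square $d_1h_1=h_0d_1$ (resp. $d_0h_1=h_0d_0$) is a pullback. Morphisms in $Difib_{Y_\bullet}$ and $Dicofib_{Y_\bullet}$ are the internal functors over $Y_\bullet$. *)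

theory Defs
  imports Main
begin

section \<open>Categories and finite limits\<close>

record ('o, 'm) cat =
  Obj :: "'o set"
  Arr :: "'m set"
  Dom :: "'m \<Rightarrow> 'o"
  Cod :: "'m \<Rightarrow> 'o"
  Id :: "'o \<Rightarrow> 'm"
  Comp :: "'m \<Rightarrow> 'm \<Rightarrow> 'm"  (infixr "\<cdot>\<index>" 70)

definition hom :: "('o, 'm) cat \<Rightarrow> 'o \<Rightarrow> 'o \<Rightarrow> 'm set" where
  "hom C A B = {f \<in> Arr C. Dom C f = A \<and> Cod C f = B}"

text \<open>Composition is written in applicative order: \<open>g \<cdot> f\<close> is \<open>f\<close> followed by \<open>g\<close>.
  Its values on non-composable pairs are irrelevant.\<close>

locale category =
  fixes C :: "('o, 'm) cat" (structure)
  assumes Dom_in_Obj: "f \<in> Arr C \<Longrightarrow> Dom C f \<in> Obj C"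
    and Cod_in_Obj: "f \<in> Arr C \<Longrightarrow> Cod C f \<in> Obj C"
    and Id_in_hom: "A \<in> Obj C \<Longrightarrow> Id C A \<in> hom C A A"
    and Comp_in_hom: "f \<in> hom C A B \<Longrightarrow> g \<in> hom C B D \<Longrightarrow> g \<cdot> f \<in> hom C A D"
    and Comp_Id_right: "f \<in> hom C A B \<Longrightarrow> f \<cdot> Id C A = f"
    and Comp_Id_left: "f \<in> hom C A B \<Longrightarrow> Id C B \<cdot> f = f"
    and Comp_assoc: "f \<in> hom C A B \<Longrightarrow> g \<in> hom C B D \<Longrightarrow> h \<in> hom C D F \<Longrightarrow>
      (h \<cdot> g) \<cdot> f = h \<cdot> (g \<cdot> f)"

definition is_functor ::
  "('a, 'b) cat \<Rightarrow> ('o, 'm) cat \<Rightarrow> ('a \<Rightarrow> 'o) \<Rightarrow> ('b \<Rightarrow> 'm) \<Rightarrow> bool" where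
  "is_functor J C F0 F1 \<longleftrightarrow>
     (\<forall>j \<in> Obj J. F0 j \<in> Obj C) \<and>
     (\<forall>a \<in> Arr J. F1 a \<in> hom C (F0 (Dom J a)) (F0 (Cod J a))) \<and>
     (\<forall>j \<in> Obj J. F1 (Id J j) = Id C (F0 j)) \<and>
     (\<forall>a \<in> Arr J. \<forall>b \<in> Arr J. Cod J a = Dom J b \<longrightarrow> F1 (b \<cdot>\<^bsub>J\<^esub> a) = F1 b \<cdot>\<^bsub>C\<^esub> F1 a)"

definition is_cone ::
  "('a, 'b) cat \<Rightarrow> ('o, 'm) cat \<Rightarrow> ('a \<Rightarrow> 'o) \<Rightarrow> ('b \<Rightarrow> 'm) \<Rightarrow> 'o \<Rightarrow> ('a \<Rightarrow> 'm) \<Rightarrow> bool" where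
  "is_cone J C F0 F1 L l \<longleftrightarrow>
     L \<in> Obj C \<and>
     (\<forall>j \<in> Obj J. l j \<in> hom C L (F0 j)) \<and>
     (\<forall>a \<in> Arr J. F1 a \<cdot>\<^bsub>C\<^esub> l (Dom J a) = l (Cod J a))"

definition is_limit ::
  "('a, 'b) cat \<Rightarrow> ('o, 'm) cat \<Rightarrow> ('a \<Rightarrow> 'o) \<Rightarrow> ('b \<Rightarrow> 'm) \<Rightarrow> 'o \<Rightarrow> ('a \<Rightarrow> 'm) \<Rightarrow> bool" where
  "is_limit J C F0 F1 L l \<longleftrightarrow>
     is_cone J C F0 F1 L l \<and>
     (\<forall>M m. is_cone J C F0 F1 M m \<longrightarrow>
        (\<exists>!u. u \<in> hom C M L \<and> (\<forall>j \<in> Obj J. l j \<cdot>\<^bsub>C\<^esub> u = m j)))"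

text \<open>Shapes over \<^typ>\<open>nat\<close> suffice: every finite category is isomorphic to one whose objects
  and arrows are natural numbers.\<close>

definition finitely_complete :: "('o, 'm) cat \<Rightarrow> bool" where
  "finitely_complete C \<longleftrightarrow>
     (\<forall>(J :: (nat, nat) cat) F0 F1.
        category J \<and> finite (Obj J) \<and> finite (Arr J) \<and> is_functor J C F0 F1 \<longrightarrow>
        (\<exists>L l. is_limit J C F0 F1 L l))"

text \<open>\<open>is_pullback C f g p q\<close>: the square \<open>f \<cdot> p = g \<cdot> q\<close> is a pullback.\<close>

definition is_pullback :: "('o, 'm) cat \<Rightarrow> 'm \<Rightarrow> 'm \<Rightarrow> 'm \<Rightarrow> 'm \<Rightarrow> bool" where
  "is_pullback C f g p q \<longleftrightarrow>
     f \<in> Arr C \<and> g \<in> Arr C \<and> Cod C f = Cod C g \<and>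
     p \<in> hom C (Dom C p) (Dom C f) \<and> q \<in> hom C (Dom C p) (Dom C g) \<and>
     f \<cdot>\<^bsub>C\<^esub> p = g \<cdot>\<^bsub>C\<^esub> q \<and>
     (\<forall>T a b. a \<in> hom C T (Dom C f) \<and> b \<in> hom C T (Dom C g) \<and> f \<cdot>\<^bsub>C\<^esub> a = g \<cdot>\<^bsub>C\<^esub> b \<longrightarrow>
        (\<exists>!u. u \<in> hom C T (Dom C p) \<and> p \<cdot>\<^bsub>C\<^esub> u = a \<and> q \<cdot>\<^bsub>C\<^esub> u = b))"


section \<open>Equivalence relations and Gumm categories\<close>

text \<open>A relation on \<open>X\<close>, i.e. a subobject of \<open>X \<times> X\<close>, is represented by a jointly monic pair of
  arrows into \<open>X\<close>. A generalized element of \<open>X\<close> is an arrow \<open>x : U \<rightarrow> X\<close>.\<close>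

definition relation_on :: "('o, 'm) cat \<Rightarrow> 'o \<Rightarrow> 'm \<times> 'm \<Rightarrow> bool" where
  "relation_on C X R \<longleftrightarrow>
     fst R \<in> Arr C \<and> snd R \<in> Arr C \<and> Dom C (fst R) = Dom C (snd R) \<and>
     Cod C (fst R) = X \<and> Cod C (snd R) = X \<and>
     (\<forall>U. \<forall>u \<in> hom C U (Dom C (fst R)). \<forall>v \<in> hom C U (Dom C (fst R)).
        fst R \<cdot>\<^bsub>C\<^esub> u = fst R \<cdot>\<^bsub>C\<^esub> v \<and> snd R \<cdot>\<^bsub>C\<^esub> u = snd R \<cdot>\<^bsub>C\<^esub> v \<longrightarrow> u = v)"

text \<open>\<open>x R y\<close> for generalized elements: the pair \<open>(x, y)\<close> factors through \<open>R\<close>.\<close>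

definition related :: "('o, 'm) cat \<Rightarrow> 'm \<times> 'm \<Rightarrow> 'm \<Rightarrow> 'm \<Rightarrow> bool" where
  "related C R x y \<longleftrightarrow>
     (\<exists>h \<in> Arr C. Cod C h = Dom C (fst R) \<and> fst R \<cdot>\<^bsub>C\<^esub> h = x \<and> snd R \<cdot>\<^bsub>C\<^esub> h = y)"

definition equivalence_relation_on :: "('o, 'm) cat \<Rightarrow> 'o \<Rightarrow> 'm \<times> 'm \<Rightarrow> bool" where
  "equivalence_relation_on C X R \<longleftrightarrow>
     relation_on C X R \<and>
     (\<forall>U \<in> Obj C. equiv (hom C U X) {(x, y). x \<in> hom C U X \<and> y \<in> hom C U X \<and> related C R x y})"

definition relation_incl :: "('o, 'm) cat \<Rightarrow> 'm \<times> 'm \<Rightarrow> 'm \<times> 'm \<Rightarrow> bool" where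
  "relation_incl C R S \<longleftrightarrow>
     (\<exists>h \<in> hom C (Dom C (fst R)) (Dom C (fst S)).
        fst S \<cdot>\<^bsub>C\<^esub> h = fst R \<and> snd S \<cdot>\<^bsub>C\<^esub> h = snd R)"

text \<open>\<open>W\<close> represents \<open>R \<inter> S\<close>, the pullback of the two subobjects of \<open>X \<times> X\<close>.\<close>

definition is_intersection ::
  "('o, 'm) cat \<Rightarrow> 'o \<Rightarrow> 'm \<times> 'm \<Rightarrow> 'm \<times> 'm \<Rightarrow> 'm \<times> 'm \<Rightarrow> bool" where
  "is_intersection C X R S W \<longleftrightarrow>
     relation_on C X W \<and>
     (\<forall>U. \<forall>x \<in> hom C U X. \<forall>y \<in> hom C U X.
        related C W x y \<longleftrightarrow> related C R x y \<and> related C S x y)"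

text \<open>Intersections are determined up to isomorphism and exist in the presence of finite limits,
  so quantifying over all \<open>W\<close> representing \<open>R \<inter> S\<close> amounts to choosing one.\<close>

definition shifting_lemma :: "('o, 'm) cat \<Rightarrow> bool" where
  "shifting_lemma C \<longleftrightarrow>
     (\<forall>X \<in> Obj C. \<forall>R S T W.
        equivalence_relation_on C X R \<and> equivalence_relation_on C X S \<and>
        equivalence_relation_on C X T \<and>
        is_intersection C X R S W \<and> relation_incl C W T \<longrightarrow>
        (\<forall>U. \<forall>x \<in> hom C U X. \<forall>y \<in> hom C U X. \<forall>x' \<in> hom C U X. \<forall>y' \<in> hom C U X.
           related C S x y \<and> related C S x' y' \<and> related C R x x' \<and> related C R y y' \<and>
           related C T x x' \<longrightarrow> related C T y y'))"

definition gumm_category :: "('o, 'm) cat \<Rightarrow> bool" where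
  "gumm_category C \<longleftrightarrow> category C \<and> finitely_complete C \<and> shifting_lemma C"


section \<open>Internal categories and internal functors\<close>

text \<open>\<open>ob2\<close> is the object of composable pairs; \<open>pr1\<close> and \<open>pr2\<close> give the first and the second arrow
  of the pair, so \<open>d1 \<cdot> pr1 = d0 \<cdot> pr2\<close>.\<close>

record ('o, 'm) icat =
  ob0 :: 'o
  ob1 :: 'o
  ob2 :: 'o
  d0 :: 'm
  d1 :: 'm
  s0 :: 'm
  pr1 :: 'm
  pr2 :: 'm
  mult :: 'm

definition composable :: "('o, 'm) cat \<Rightarrow> ('o, 'm) icat \<Rightarrow> 'm \<Rightarrow> 'm \<Rightarrow> bool" where
  "composable E X f g \<longleftrightarrow>
     (\<exists>U. f \<in> hom E U (ob1 X) \<and> g \<in> hom E U (ob1 X)) \<and> d1 X \<cdot>\<^bsub>E\<^esub> f = d0 X \<cdot>\<^bsub>E\<^esub> g"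

text \<open>Composite (first \<open>f\<close>, then \<open>g\<close>) of composable generalized elements of \<open>ob1 X\<close>.\<close>

definition icomp :: "('o, 'm) cat \<Rightarrow> ('o, 'm) icat \<Rightarrow> 'm \<Rightarrow> 'm \<Rightarrow> 'm" where
  "icomp E X f g =
     mult X \<cdot>\<^bsub>E\<^esub>
       (THE u. u \<in> hom E (Dom E f) (ob2 X) \<and> pr1 X \<cdot>\<^bsub>E\<^esub> u = f \<and> pr2 X \<cdot>\<^bsub>E\<^esub> u = g)"

definition internal_category :: "('o, 'm) cat \<Rightarrow> ('o, 'm) icat \<Rightarrow> bool" where
  "internal_category E X \<longleftrightarrow>
     d0 X \<in> hom E (ob1 X) (ob0 X) \<and> d1 X \<in> hom E (ob1 X) (ob0 X) \<and>
     s0 X \<in> hom E (ob0 X) (ob1 X) \<and>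
     d0 X \<cdot>\<^bsub>E\<^esub> s0 X = Id E (ob0 X) \<and> d1 X \<cdot>\<^bsub>E\<^esub> s0 X = Id E (ob0 X) \<and>
     Dom E (pr1 X) = ob2 X \<and> is_pullback E (d1 X) (d0 X) (pr1 X) (pr2 X) \<and>
     mult X \<in> hom E (ob2 X) (ob1 X) \<and>
     d0 X \<cdot>\<^bsub>E\<^esub> mult X = d0 X \<cdot>\<^bsub>E\<^esub> pr1 X \<and> d1 X \<cdot>\<^bsub>E\<^esub> mult X = d1 X \<cdot>\<^bsub>E\<^esub> pr2 X \<and>
     (\<forall>U. \<forall>f \<in> hom E U (ob1 X).
        icomp E X (s0 X \<cdot>\<^bsub>E\<^esub> (d0 X \<cdot>\<^bsub>E\<^esub> f)) f = f \<and>
        icomp E X f (s0 X \<cdot>\<^bsub>E\<^esub> (d1 X \<cdot>\<^bsub>E\<^esub> f)) = f) \<and>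
     (\<forall>f g h. composable E X f g \<and> composable E X g h \<longrightarrow>
        icomp E X (icomp E X f g) h = icomp E X f (icomp E X g h))"

text \<open>An internal functor is a pair \<open>(h0, h1)\<close> of its object part and its arrow part.\<close>

definition internal_functor ::
  "('o, 'm) cat \<Rightarrow> ('o, 'm) icat \<Rightarrow> ('o, 'm) icat \<Rightarrow> 'm \<times> 'm \<Rightarrow> bool" where
  "internal_functor E X Y h \<longleftrightarrow>
     fst h \<in> hom E (ob0 X) (ob0 Y) \<and> snd h \<in> hom E (ob1 X) (ob1 Y) \<and>
     d0 Y \<cdot>\<^bsub>E\<^esub> snd h = fst h \<cdot>\<^bsub>E\<^esub> d0 X \<and>
     d1 Y \<cdot>\<^bsub>E\<^esub> snd h = fst h \<cdot>\<^bsub>E\<^esub> d1 X \<and>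
     s0 Y \<cdot>\<^bsub>E\<^esub> fst h = snd h \<cdot>\<^bsub>E\<^esub> s0 X \<and>
     snd h \<cdot>\<^bsub>E\<^esub> mult X = icomp E Y (snd h \<cdot>\<^bsub>E\<^esub> pr1 X) (snd h \<cdot>\<^bsub>E\<^esub> pr2 X)"

definition ifun_id :: "('o, 'm) cat \<Rightarrow> ('o, 'm) icat \<Rightarrow> 'm \<times> 'm" where
  "ifun_id E X = (Id E (ob0 X), Id E (ob1 X))"

definition ifun_comp :: "('o, 'm) cat \<Rightarrow> 'm \<times> 'm \<Rightarrow> 'm \<times> 'm \<Rightarrow> 'm \<times> 'm" where
  "ifun_comp E g f = (fst g \<cdot>\<^bsub>E\<^esub> fst f, snd g \<cdot>\<^bsub>E\<^esub> snd f)"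

definition discrete_fibration ::
  "('o, 'm) cat \<Rightarrow> ('o, 'm) icat \<Rightarrow> ('o, 'm) icat \<Rightarrow> 'm \<times> 'm \<Rightarrow> bool" where
  "discrete_fibration E X Y h \<longleftrightarrow>
     internal_functor E X Y h \<and> is_pullback E (d1 Y) (fst h) (snd h) (d1 X)"

definition discrete_cofibration ::
  "('o, 'm) cat \<Rightarrow> ('o, 'm) icat \<Rightarrow> ('o, 'm) icat \<Rightarrow> 'm \<times> 'm \<Rightarrow> bool" where
  "discrete_cofibration E X Y h \<longleftrightarrow>
     internal_functor E X Y h \<and> is_pullback E (d0 Y) (fst h) (snd h) (d0 X)"


section \<open>Discrete (co)fibrations above an internal category\<close>

text \<open>An object above \<open>Y\<close> is an internal category together with an internal functor to \<open>Y\<close>. Arrows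
  carry their domain and codomain.\<close>

type_synonym ('o, 'm) over_obj = "('o, 'm) icat \<times> 'm \<times> 'm"
type_synonym ('o, 'm) over_arr = "('o, 'm) over_obj \<times> ('m \<times> 'm) \<times> ('o, 'm) over_obj"

text \<open>The category with objects \<open>D\<close> and as arrows \<open>(X, h) \<rightarrow> (X', h')\<close> all internal functors
  \<open>f : X \<rightarrow> X'\<close> with \<open>h' \<cdot> f = h\<close>.\<close>

definition over_cat ::
  "('o, 'm) cat \<Rightarrow> ('o, 'm) over_obj set \<Rightarrow> (('o, 'm) over_obj, ('o, 'm) over_arr) cat" where
  "over_cat E D =
     \<lparr> Obj = D,
       Arr = {(A, f, B). A \<in> D \<and> B \<in> D \<and> internal_functor E (fst A) (fst B) f \<and>
                ifun_comp E (snd B) f = snd A},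
       Dom = (\<lambda>(A, f, B). A),
       Cod = (\<lambda>(A, f, B). B),
       Id = (\<lambda>A. (A, ifun_id E (fst A), A)),
       Comp = (\<lambda>(B', g, C) (A, f, B). (A, ifun_comp E g f, C)) \<rparr>"

definition Difib ::
  "('o, 'm) cat \<Rightarrow> ('o, 'm) icat \<Rightarrow> (('o, 'm) over_obj, ('o, 'm) over_arr) cat" where
  "Difib E Y = over_cat E {(X, h). internal_category E X \<and> discrete_fibration E X Y h}"

definition Dicofib ::
  "('o, 'm) cat \<Rightarrow> ('o, 'm) icat \<Rightarrow> (('o, 'm) over_obj, ('o, 'm) over_arr) cat" where
  "Dicofib E Y = over_cat E {(X, h). internal_category E X \<and> discrete_cofibration E X Y h}"

end

theory Submission
  imports Defs
begin

text \<open>A discrete fibration above \<open>Y\<close> is an internal presheaf, that is, an arrow \<open>a : A \<rightarrow> ob0 Y\<close> with an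
  action of the arrows of \<open>Y\<close>. A limit of presheaves is a limit over \<open>ob0 Y\<close> of the underlying
  objects, with the induced action. The forgetful functor to \<open>E / ob0 Y\<close> has a left adjoint, the free
  action, so generalized elements of the underlying object over a given \<open>a\<close> are arrows from a free
  action; hence the functor preserves equivalence relations and their intersections, and the
  Shifting Lemma of \<open>E\<close> applies to the underlying relations. The factorization through \<open>T\<close> which it
  yields is automatically equivariant, because the projections of \<open>T\<close> are jointly monic in \<open>E\<close>. Discrete
  cofibrations are discrete fibrations of the opposite internal categories.\<close>

section \<open>Pullbacks and limits over an object\<close>

text \<open>Equivalence relations between presheaves are tested on presheaves, whereas the Shifting
  Lemma of \<open>E\<close> needs them tested on all arrows into the underlying object. Free actions
  bridge this gap one fibre at a time: an element \<open>x\<close> lies over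
  \<open>b A \<cdot> x\<close>, so each \<open>x\<close> selects its own free action. This reaches
  \<open>E\<close> itself and not merely its slice over \<open>ob0 Y\<close>, because the
  projections of a relation between presheaves are maps over \<open>ob0 Y\<close>: related elements
  always share a fibre, so reflexivity, symmetry, transitivity and intersections are all decided
  within one fibre. In the Shifting Lemma itself the elements are already maps of presheaves, and
  functoriality carries them to \<open>E\<close>; only the factorization obtained there has to be
  brought back. Computing with generalized elements keeps the action laws equational, and pullbacks
  are chosen only where an object must be built: for the category of elements and for the free
  action.\<close>

lemma hom_iff: "f \<in> hom C A B \<longleftrightarrow> f \<in> Arr C \<and> Dom C f = A \<and> Cod C f = B"
  by (auto simp: hom_def)

text \<open>The axioms are stated with bounded quantifiers over \<open>Obj C\<close> and
  \<open>Arr C\<close>, which \<open>add_terminal_simps\<close> can then split into the different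
  kinds of objects and arrows.\<close>

lemma categoryI:
  assumes "\<forall>f\<in>Arr C. Dom C f \<in> Obj C \<and> Cod C f \<in> Obj C"
    and "\<forall>A\<in>Obj C. Id C A \<in> hom C A A"
    and "\<forall>f\<in>Arr C. \<forall>g\<in>Arr C. Cod C f = Dom C g \<longrightarrow> g \<cdot>\<^bsub>C\<^esub> f \<in> hom C (Dom C f) (Cod C g)"
    and "\<forall>f\<in>Arr C. f \<cdot>\<^bsub>C\<^esub> Id C (Dom C f) = f \<and> Id C (Cod C f) \<cdot>\<^bsub>C\<^esub> f = f"
    and "\<forall>f\<in>Arr C. \<forall>g\<in>Arr C. \<forall>h\<in>Arr C. Cod C f = Dom C g \<and> Cod C g = Dom C h \<longrightarrow>
      (h \<cdot>\<^bsub>C\<^esub> g) \<cdot>\<^bsub>C\<^esub> f = h \<cdot>\<^bsub>C\<^esub> (g \<cdot>\<^bsub>C\<^esub> f)"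
  shows "category C"
  using assms by unfold_locales (auto simp: hom_iff)

text \<open>The description is the one inside \<open>icomp\<close>, which is therefore
  \<open>mult\<close> after a \<open>lift\<close>.\<close>

definition lift :: "('o, 'm) cat \<Rightarrow> 'm \<Rightarrow> 'm \<Rightarrow> 'm \<Rightarrow> 'm \<Rightarrow> 'm" where
  "lift C p q a b = (THE u. u \<in> hom C (Dom C a) (Dom C p) \<and> p \<cdot>\<^bsub>C\<^esub> u = a \<and> q \<cdot>\<^bsub>C\<^esub> u = b)"

context category
begin

lemma arr_comp [simp]:
  assumes "f \<in> Arr C" "g \<in> Arr C" "Cod C f = Dom C g"
  shows "g \<cdot> f \<in> Arr C" "Dom C (g \<cdot> f) = Dom C f" "Cod C (g \<cdot> f) = Cod C g"
  using Comp_in_hom[of f "Dom C f" "Cod C f" g "Cod C g"] assms by (auto simp: hom_iff)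

lemma arr_Id [simp]:
  assumes "A \<in> Obj C"
  shows "Id C A \<in> Arr C" "Dom C (Id C A) = A" "Cod C (Id C A) = A"
  using Id_in_hom[OF assms] by (auto simp: hom_iff)

lemma Dom_Obj [simp]: "f \<in> Arr C \<Longrightarrow> Dom C f \<in> Obj C"
  by (rule Dom_in_Obj)

lemma Cod_Obj [simp]: "f \<in> Arr C \<Longrightarrow> Cod C f \<in> Obj C"
  by (rule Cod_in_Obj)

lemma comp_Id [simp]: "f \<in> Arr C \<Longrightarrow> Dom C f = A \<Longrightarrow> f \<cdot> Id C A = f"
  by (rule Comp_Id_right) (simp add: hom_iff)

lemma Id_comp [simp]: "f \<in> Arr C \<Longrightarrow> Cod C f = A \<Longrightarrow> Id C A \<cdot> f = f"
  by (rule Comp_Id_left) (simp add: hom_iff)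

lemma comp_assoc:
  "f \<in> Arr C \<Longrightarrow> g \<in> Arr C \<Longrightarrow> h \<in> Arr C \<Longrightarrow> Cod C f = Dom C g \<Longrightarrow> Cod C g = Dom C h \<Longrightarrow>
    (h \<cdot> g) \<cdot> f = h \<cdot> (g \<cdot> f)"
  by (rule Comp_assoc) (auto simp: hom_iff)

text \<open>The form in which a commuting square is applied to a generalized element
  \<open>u\<close>: composites are kept nested to the right, where the equation does not match
  directly.\<close>

lemma comp_eq_extend:
  assumes "g \<cdot> f = g' \<cdot> f'" "u \<in> Arr C" "f \<in> Arr C" "f' \<in> Arr C" "g \<in> Arr C" "g' \<in> Arr C"
    "Cod C u = Dom C f" "Cod C u = Dom C f'" "Cod C f = Dom C g" "Cod C f' = Dom C g'"
  shows "g \<cdot> (f \<cdot> u) = g' \<cdot> (f' \<cdot> u)"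
  using assms by (metis comp_assoc)

lemma comp_eq_extend1:
  assumes "g \<cdot> f = k" "u \<in> Arr C" "f \<in> Arr C" "g \<in> Arr C" "Cod C u = Dom C f" "Cod C f = Dom C g"
  shows "g \<cdot> (f \<cdot> u) = k \<cdot> u"
  using assms by (metis comp_assoc)

lemma pullback_arr:
  assumes "is_pullback C f g p q"
  shows "f \<in> Arr C" "g \<in> Arr C" "p \<in> Arr C" "q \<in> Arr C" "Cod C f = Cod C g"
    "Dom C q = Dom C p" "Cod C p = Dom C f" "Cod C q = Dom C g" "f \<cdot> p = g \<cdot> q"
  using assms by (auto simp: is_pullback_def hom_iff)

lemma pullback_eqI:
  assumes pb: "is_pullback C f g p q"
    and u: "u \<in> Arr C" "Cod C u = Dom C p" and v: "v \<in> Arr C" "Cod C v = Dom C p"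
    and D: "Dom C u = Dom C v"
    and eq: "p \<cdot> u = p \<cdot> v" "q \<cdot> u = q \<cdot> v"
  shows "u = v"
proof -
  note [simp] = pullback_arr(1-8)[OF pb]
  have "f \<cdot> (p \<cdot> v) = g \<cdot> (q \<cdot> v)"
    by (rule comp_eq_extend) (simp_all add: pullback_arr[OF pb] v)
  moreover have "p \<cdot> v \<in> hom C (Dom C v) (Dom C f)" "q \<cdot> v \<in> hom C (Dom C v) (Dom C g)"
    using v by (simp_all add: hom_iff)
  ultimately have "\<exists>!w. w \<in> hom C (Dom C v) (Dom C p) \<and> p \<cdot> w = p \<cdot> v \<and> q \<cdot> w = q \<cdot> v"
    using pb unfolding is_pullback_def by blast
  then show ?thesis using u v D eq by (auto simp: hom_iff)
qed

lemma lift_works: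
  assumes pb: "is_pullback C f g p q"
    and "a \<in> Arr C" "b \<in> Arr C" "Dom C a = Dom C b" "Cod C a = Dom C f" "Cod C b = Dom C g"
    "f \<cdot> a = g \<cdot> b"
  shows "lift C p q a b \<in> Arr C" "Dom C (lift C p q a b) = Dom C a"
    "Cod C (lift C p q a b) = Dom C p" "p \<cdot> lift C p q a b = a" "q \<cdot> lift C p q a b = b"
proof -
  have "a \<in> hom C (Dom C a) (Dom C f)" "b \<in> hom C (Dom C a) (Dom C g)"
    using assms by (auto simp: hom_iff)
  then have "\<exists>!u. u \<in> hom C (Dom C a) (Dom C p) \<and> p \<cdot> u = a \<and> q \<cdot> u = b"
    using pb assms(7) unfolding is_pullback_def by blast
  from theI'[OF this] show "lift C p q a b \<in> Arr C" "Dom C (lift C p q a b) = Dom C a"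
    "Cod C (lift C p q a b) = Dom C p" "p \<cdot> lift C p q a b = a" "q \<cdot> lift C p q a b = b"
    by (auto simp: hom_iff lift_def)
qed

lemma lift_eqI:
  assumes pb: "is_pullback C f g p q"
    and u: "u \<in> Arr C" "Cod C u = Dom C p" "p \<cdot> u = a" "q \<cdot> u = b"
  shows "lift C p q a b = u"
proof -
  note [simp] = pullback_arr(1-8)[OF pb]
  have ab: "a \<in> Arr C" "b \<in> Arr C" "Dom C a = Dom C u" "Dom C b = Dom C u"
    "Cod C a = Dom C f" "Cod C b = Dom C g"
    using u(1,2) by (auto simp flip: u(3,4))
  have "f \<cdot> a = g \<cdot> b"
    unfolding u(3,4)[symmetric] by (rule comp_eq_extend) (simp_all add: pullback_arr[OF pb] u)
  note l = lift_works[OF pb ab(1,2) _ ab(5,6) this]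
  show ?thesis
    by (rule pullback_eqI[OF pb]) (use l ab u in auto)
qed

lemma lift_comp:
  assumes pb: "is_pullback C f g p q"
    and ab: "a \<in> Arr C" "b \<in> Arr C" "Dom C a = Dom C b" "Cod C a = Dom C f" "Cod C b = Dom C g"
    "f \<cdot> a = g \<cdot> b"
    and u: "u \<in> Arr C" "Cod C u = Dom C a"
  shows "lift C p q (a \<cdot> u) (b \<cdot> u) = lift C p q a b \<cdot> u"
proof (rule lift_eqI[OF pb])
  note [simp] = pullback_arr(1-8)[OF pb] lift_works[OF pb ab]
  show "p \<cdot> (lift C p q a b \<cdot> u) = a \<cdot> u" "q \<cdot> (lift C p q a b \<cdot> u) = b \<cdot> u"
    by (rule comp_eq_extend1; simp add: u)+
qed (use lift_works[OF pb ab] u in auto)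

end

section \<open>Pullbacks and slice limits from finite completeness\<close>

lemma pullback_exists:
  assumes "category C" "finitely_complete C" "f \<in> Arr C" "g \<in> Arr C" "Cod C f = Cod C g"
  obtains p q where "is_pullback C f g p q"
proof -
  interpret category C by fact
  \<comment> \<open>The cospan shape: arrows 0, 1, 2 are the identities, 3 goes from 0 to 2 and 4
    from 1 to 2. One of two composable arrows is always an identity, so the composite is the other
    one.\<close>
  define J :: "(nat, nat) cat" where "J = \<lparr>Obj = {0,1,2}, Arr = {0,1,2,3,4},
    Dom = (\<lambda>a. if a \<le> 2 then a else a - 3), Cod = (\<lambda>a. if a \<le> 2 then a else 2), Id = (\<lambda>a. a),
    Comp = (\<lambda>b a. if a \<le> 2 then b else a)\<rparr>"
  define F0 where "F0 j = (if j = 0 then Dom C f else if j = 1 then Dom C g else Cod C f)" for j :: nat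
  define F1 where "F1 a = (if a \<le> 2 then Id C (F0 a) else if a = 3 then f else g)" for a :: nat
  have "category J"
    by unfold_locales (auto simp: J_def hom_iff)
  moreover have "is_functor J C F0 F1"
    using assms by (auto simp: is_functor_def J_def F0_def F1_def hom_iff)
  moreover have "finite (Obj J)" "finite (Arr J)" by (auto simp: J_def)
  ultimately obtain L l where lim: "is_limit J C F0 F1 L l"
    using assms(2) unfolding finitely_complete_def by blast
  have cone_iff: "is_cone J C F0 F1 M m \<longleftrightarrow> m 0 \<in> hom C M (Dom C f) \<and> m 1 \<in> hom C M (Dom C g) \<and>
      m 2 = f \<cdot>\<^bsub>C\<^esub> m 0 \<and> f \<cdot>\<^bsub>C\<^esub> m 0 = g \<cdot>\<^bsub>C\<^esub> m 1" for M m
    using assms by (auto simp: is_cone_def J_def F0_def F1_def hom_iff)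
  have c: "is_cone J C F0 F1 L l" using lim by (auto simp: is_limit_def)
  have "is_pullback C f g (l 0) (l 1)"
    unfolding is_pullback_def
  proof (intro conjI allI impI)
    fix T a b
    assume ab: "a \<in> hom C T (Dom C f) \<and> b \<in> hom C T (Dom C g) \<and> f \<cdot>\<^bsub>C\<^esub> a = g \<cdot>\<^bsub>C\<^esub> b"
    define m where "m j = (if j = 0 then a else if j = 1 then b else f \<cdot>\<^bsub>C\<^esub> a)" for j :: nat
    have "is_cone J C F0 F1 T m" using ab by (simp add: cone_iff m_def)
    then have "\<exists>!u. u \<in> hom C T L \<and> (\<forall>j \<in> Obj J. l j \<cdot>\<^bsub>C\<^esub> u = m j)"
      using lim by (auto simp: is_limit_def)
    moreover have "u \<in> hom C T L \<and> (\<forall>j \<in> Obj J. l j \<cdot>\<^bsub>C\<^esub> u = m j) \<longleftrightarrow>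
        u \<in> hom C T (Dom C (l 0)) \<and> l 0 \<cdot>\<^bsub>C\<^esub> u = a \<and> l 1 \<cdot>\<^bsub>C\<^esub> u = b" for u
    proof -
      have "l 0 \<in> Arr C" "Dom C (l 0) = L" "Cod C (l 0) = Dom C f" "l 2 = f \<cdot>\<^bsub>C\<^esub> l 0"
        using c by (auto simp: cone_iff hom_iff)
      moreover have "u \<in> Arr C \<and> Cod C u = L \<Longrightarrow> (f \<cdot>\<^bsub>C\<^esub> l 0) \<cdot>\<^bsub>C\<^esub> u = f \<cdot>\<^bsub>C\<^esub> (l 0 \<cdot>\<^bsub>C\<^esub> u)"
        using calculation assms by (simp add: comp_assoc)
      ultimately show ?thesis by (auto simp: J_def m_def hom_iff)
    qed
    ultimately show "\<exists>!u. u \<in> hom C T (Dom C (l 0)) \<and> l 0 \<cdot>\<^bsub>C\<^esub> u = a \<and> l 1 \<cdot>\<^bsub>C\<^esub> u = b"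
      by simp
  qed (use c assms in \<open>auto simp: cone_iff hom_iff\<close>)
  then show ?thesis by (rule that)
qed

text \<open>A diagram in the slice over \<open>B\<close> is a diagram in \<open>C\<close> whose shape is the given one with a
  terminal object added. The new object is encoded as \<open>0\<close> and the old ones as \<open>Suc j\<close>; the old
  arrows become \<open>2 * a + 1\<close>, and \<open>2 * j + 2\<close> is the arrow from \<open>j\<close> to the new object.\<close>

definition add_terminal :: "(nat, nat) cat \<Rightarrow> (nat, nat) cat" where
  "add_terminal J = \<lparr>Obj = insert 0 (Suc ` Obj J),
     Arr = insert 0 ((\<lambda>a. 2 * a + 1) ` Arr J \<union> (\<lambda>j. 2 * j + 2) ` Obj J),
     Dom = (\<lambda>a. if a = 0 then 0 else if odd a then Suc (Dom J (a div 2)) else a div 2),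
     Cod = (\<lambda>a. if odd a then Suc (Cod J (a div 2)) else 0),
     Id = (\<lambda>j. if j = 0 then 0 else 2 * Id J (j - 1) + 1),
     Comp = (\<lambda>b a. if even a then a else if even b then 2 * Dom J (a div 2) + 2
       else 2 * ((b div 2) \<cdot>\<^bsub>J\<^esub> (a div 2)) + 1)\<rparr>"

lemma add_terminal_simps:
  "(\<forall>a\<in>Arr (add_terminal J). P a) \<longleftrightarrow>
    P 0 \<and> (\<forall>a\<in>Arr J. P (2 * a + 1)) \<and> (\<forall>j\<in>Obj J. P (2 * j + 2))"
  "(\<forall>j\<in>Obj (add_terminal J). Q j) \<longleftrightarrow> Q 0 \<and> (\<forall>j\<in>Obj J. Q (Suc j))"
  by (auto simp: add_terminal_def)

lemma category_add_terminal:
  assumes "category J"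
  shows "category (add_terminal J)"
proof -
  interpret category J by fact
  show ?thesis
    by (rule categoryI; unfold add_terminal_simps)
      (auto simp: add_terminal_def hom_iff comp_assoc)
qed

text \<open>Once \<open>B\<close> is adjoined as a terminal vertex, a cone is a cone over the old
  diagram together with an arrow to \<open>B\<close> through which all legs agree. The arrow
  \<open>c\<close> is kept apart from the legs for the sake of the empty shape, where no leg
  determines it and the limit is \<open>B\<close> up to isomorphism.\<close>

lemma limit_over_exists:
  fixes J :: "(nat, nat) cat"
  assumes "category C" "finitely_complete C"
    and J: "category J" "finite (Obj J)" "finite (Arr J)" and F: "is_functor J C F0 F1"
    and B: "B \<in> Obj C" and b: "\<And>j. j \<in> Obj J \<Longrightarrow> b j \<in> hom C (F0 j) B"
    and b_nat: "\<And>a. a \<in> Arr J \<Longrightarrow> b (Cod J a) \<cdot>\<^bsub>C\<^esub> F1 a = b (Dom J a)"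
  shows "\<exists>L l c. c \<in> hom C L B \<and> is_cone J C F0 F1 L l \<and> (\<forall>j\<in>Obj J. b j \<cdot>\<^bsub>C\<^esub> l j = c) \<and>
    (\<forall>M m e. e \<in> hom C M B \<and> is_cone J C F0 F1 M m \<and> (\<forall>j\<in>Obj J. b j \<cdot>\<^bsub>C\<^esub> m j = e) \<longrightarrow>
      (\<exists>!u. u \<in> hom C M L \<and> c \<cdot>\<^bsub>C\<^esub> u = e \<and> (\<forall>j\<in>Obj J. l j \<cdot>\<^bsub>C\<^esub> u = m j)))"
proof -
  interpret category C by fact
  interpret J: category J by fact
  let ?J = "add_terminal J"
  define G0 where "G0 j = (if j = 0 then B else F0 (j - 1))" for j
  \<comment> \<open>The code \<open>2 * j + 2\<close> halves to \<open>j + 1\<close>, hence the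
    subtraction; an odd code \<open>2 * a + 1\<close> halves to \<open>a\<close>.\<close>
  define G1 where "G1 a = (if a = 0 then Id C B else if odd a then F1 (a div 2) else b (a div 2 - 1))" for a
  have 1: "F0 j \<in> Obj C" "b j \<in> Arr C" "Dom C (b j) = F0 j" "Cod C (b j) = B"
    if "j \<in> Obj J" for j
    using F that b[OF that] by (auto simp: is_functor_def hom_iff)
  have 2: "F1 a \<in> Arr C" "Dom C (F1 a) = F0 (Dom J a)" "Cod C (F1 a) = F0 (Cod J a)"
    if "a \<in> Arr J" for a
    using F that by (auto simp: is_functor_def hom_iff)
  have 3: "F1 (Id J j) = Id C (F0 j)" if "j \<in> Obj J" for j
    using F that by (auto simp: is_functor_def hom_iff)
  have 4: "F1 (g \<cdot>\<^bsub>J\<^esub> f) = F1 g \<cdot>\<^bsub>C\<^esub> F1 f" if "f \<in> Arr J" "g \<in> Arr J" "Cod J f = Dom J g" for f g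
    using F that by (auto simp: is_functor_def hom_iff)
  have "is_functor ?J C G0 G1"
    unfolding is_functor_def add_terminal_simps
    by (simp add: add_terminal_def G0_def G1_def hom_iff 1 2 3 4 B b_nat)
  moreover have "finite (Obj ?J)" "finite (Arr ?J)" using J by (auto simp: add_terminal_def)
  ultimately obtain L l where lim: "is_limit ?J C G0 G1 L l"
    using assms(2) category_add_terminal[OF J(1)] unfolding finitely_complete_def by blast
  have cone_iff: "is_cone ?J C G0 G1 M m \<longleftrightarrow> m 0 \<in> hom C M B \<and>
    is_cone J C F0 F1 M (\<lambda>j. m (Suc j)) \<and> (\<forall>j\<in>Obj J. b j \<cdot>\<^bsub>C\<^esub> m (Suc j) = m 0)" for M m
    unfolding is_cone_def add_terminal_simps
    by (auto simp: add_terminal_def G0_def G1_def hom_iff B)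
  have c: "is_cone ?J C G0 G1 L l" using lim by (auto simp: is_limit_def)
  show ?thesis
  proof (rule exI[of _ L], rule exI[of _ "\<lambda>j. l (Suc j)"], rule exI[of _ "l 0"], intro conjI allI impI)
    fix M m e
    assume "e \<in> hom C M B \<and> is_cone J C F0 F1 M m \<and> (\<forall>j\<in>Obj J. b j \<cdot>\<^bsub>C\<^esub> m j = e)"
    then have "is_cone ?J C G0 G1 M (case_nat e m)" by (simp add: cone_iff)
    then have "\<exists>!u. u \<in> hom C M L \<and> (\<forall>j \<in> Obj ?J. l j \<cdot>\<^bsub>C\<^esub> u = case_nat e m j)"
      using lim by (auto simp: is_limit_def)
    then show "\<exists>!u. u \<in> hom C M L \<and> l 0 \<cdot>\<^bsub>C\<^esub> u = e \<and> (\<forall>j \<in> Obj J. l (Suc j) \<cdot>\<^bsub>C\<^esub> u = m j)"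
      by (simp add: add_terminal_def)
  qed (use c cone_iff in auto)
qed

section \<open>Internal categories on generalized elements\<close>

lemma composable_iff:
  "composable E X f g \<longleftrightarrow> f \<in> Arr E \<and> g \<in> Arr E \<and> Dom E f = Dom E g \<and>
    Cod E f = ob1 X \<and> Cod E g = ob1 X \<and> d1 X \<cdot>\<^bsub>E\<^esub> f = d0 X \<cdot>\<^bsub>E\<^esub> g"
  by (auto simp: composable_def hom_iff)

lemma icomp_lift: "Dom E (pr1 X) = ob2 X \<Longrightarrow> icomp E X f g = mult X \<cdot>\<^bsub>E\<^esub> lift E (pr1 X) (pr2 X) f g"
  by (simp add: icomp_def lift_def)

locale internal_cat = category E for E :: "('o, 'm) cat" (structure) +
  fixes X :: "('o, 'm) icat"
  assumes internal_category: "internal_category E X"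
begin

lemma internal_arr [simp]:
  "d0 X \<in> Arr E" "Dom E (d0 X) = ob1 X" "Cod E (d0 X) = ob0 X"
  "d1 X \<in> Arr E" "Dom E (d1 X) = ob1 X" "Cod E (d1 X) = ob0 X"
  "s0 X \<in> Arr E" "Dom E (s0 X) = ob0 X" "Cod E (s0 X) = ob1 X"
  "pr1 X \<in> Arr E" "Dom E (pr1 X) = ob2 X" "Cod E (pr1 X) = ob1 X"
  "pr2 X \<in> Arr E" "Dom E (pr2 X) = ob2 X" "Cod E (pr2 X) = ob1 X"
  "mult X \<in> Arr E" "Dom E (mult X) = ob2 X" "Cod E (mult X) = ob1 X"
  using internal_category by (auto simp: internal_category_def hom_iff is_pullback_def)

lemma ob_in_Obj [simp]: "ob0 X \<in> Obj E" "ob1 X \<in> Obj E" "ob2 X \<in> Obj E"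
  using Dom_in_Obj[of "s0 X"] Dom_in_Obj[of "d0 X"] Dom_in_Obj[of "mult X"] by simp_all

lemma pb: "is_pullback E (d1 X) (d0 X) (pr1 X) (pr2 X)"
  using internal_category by (simp add: internal_category_def)

lemma d0_s0 [simp]: "d0 X \<cdot> s0 X = Id E (ob0 X)" and d1_s0 [simp]: "d1 X \<cdot> s0 X = Id E (ob0 X)"
  using internal_category by (auto simp: internal_category_def)

lemma d0_s0_elt [simp]: "x \<in> Arr E \<Longrightarrow> Cod E x = ob0 X \<Longrightarrow> d0 X \<cdot> (s0 X \<cdot> x) = x"
  and d1_s0_elt [simp]: "x \<in> Arr E \<Longrightarrow> Cod E x = ob0 X \<Longrightarrow> d1 X \<cdot> (s0 X \<cdot> x) = x"
  by (simp_all flip: comp_assoc)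

lemma d0_mult: "d0 X \<cdot> mult X = d0 X \<cdot> pr1 X" and d1_mult: "d1 X \<cdot> mult X = d1 X \<cdot> pr2 X"
  using internal_category by (auto simp: internal_category_def)

lemma icomp_eq_lift: "icomp E X f g = mult X \<cdot> lift E (pr1 X) (pr2 X) f g"
  by (simp add: icomp_lift)

lemma composable_pr: "composable E X (pr1 X) (pr2 X)"
  using pullback_arr(9)[OF pb] by (auto simp: composable_iff)

lemma lift_pr:
  assumes "composable E X f g"
  defines "l \<equiv> lift E (pr1 X) (pr2 X) f g"
  shows "l \<in> Arr E" "Dom E l = Dom E f" "Cod E l = ob2 X" "pr1 X \<cdot> l = f" "pr2 X \<cdot> l = g"
  using lift_works[OF pb, of f g] assms by (auto simp: composable_iff)

lemma icomp_arr:
  assumes "composable E X f g"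
  shows "icomp E X f g \<in> Arr E" "Dom E (icomp E X f g) = Dom E f" "Cod E (icomp E X f g) = ob1 X"
    "d0 X \<cdot> icomp E X f g = d0 X \<cdot> f" "d1 X \<cdot> icomp E X f g = d1 X \<cdot> g"
proof -
  note [simp] = lift_pr[OF assms]
  show "icomp E X f g \<in> Arr E" "Dom E (icomp E X f g) = Dom E f" "Cod E (icomp E X f g) = ob1 X"
    by (simp_all add: icomp_eq_lift)
  show "d0 X \<cdot> icomp E X f g = d0 X \<cdot> f" "d1 X \<cdot> icomp E X f g = d1 X \<cdot> g"
    by (simp_all add: icomp_eq_lift comp_eq_extend[OF d0_mult] comp_eq_extend[OF d1_mult])
qed

text \<open>Mediating arrows into a pullback are natural in the test object, hence so is
  composition. By this, identities between composites can be proved for generic elements and then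
  transported.\<close>

lemma icomp_comp:
  assumes "composable E X f g" "u \<in> Arr E" "Cod E u = Dom E f"
  shows "icomp E X (f \<cdot> u) (g \<cdot> u) = icomp E X f g \<cdot> u"
  using assms lift_pr[OF assms(1)] lift_comp[OF pb, of f g u]
  by (simp add: icomp_eq_lift composable_iff comp_assoc)

lemma icomp_unit:
  assumes "f \<in> Arr E" "Cod E f = ob1 X"
  shows "icomp E X (s0 X \<cdot> (d0 X \<cdot> f)) f = f" "icomp E X f (s0 X \<cdot> (d1 X \<cdot> f)) = f"
  using internal_category assms by (auto simp: internal_category_def hom_iff)

lemma icomp_assoc:
  "composable E X f g \<Longrightarrow> composable E X g h \<Longrightarrow>
    icomp E X (icomp E X f g) h = icomp E X f (icomp E X g h)"
  using internal_category by (auto simp: internal_category_def)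

text \<open>The projections are the generic composable pair, whose mediating arrow is the
  identity.\<close>

lemma icomp_pr: "icomp E X (pr1 X) (pr2 X) = mult X"
proof -
  have "lift E (pr1 X) (pr2 X) (pr1 X) (pr2 X) = Id E (ob2 X)"
    by (rule lift_eqI[OF pb]) simp_all
  then show ?thesis by (simp add: icomp_eq_lift)
qed

end

lemma internal_functor_arr:
  assumes "internal_functor E X Y h"
  shows "fst h \<in> Arr E" "Dom E (fst h) = ob0 X" "Cod E (fst h) = ob0 Y"
    "snd h \<in> Arr E" "Dom E (snd h) = ob1 X" "Cod E (snd h) = ob1 Y"
    "d0 Y \<cdot>\<^bsub>E\<^esub> snd h = fst h \<cdot>\<^bsub>E\<^esub> d0 X" "d1 Y \<cdot>\<^bsub>E\<^esub> snd h = fst h \<cdot>\<^bsub>E\<^esub> d1 X"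
    "s0 Y \<cdot>\<^bsub>E\<^esub> fst h = snd h \<cdot>\<^bsub>E\<^esub> s0 X"
  using assms by (auto simp: internal_functor_def hom_iff)

lemma internal_functor_mult:
  "internal_functor E X Y h \<Longrightarrow>
    snd h \<cdot>\<^bsub>E\<^esub> mult X = icomp E Y (snd h \<cdot>\<^bsub>E\<^esub> pr1 X) (snd h \<cdot>\<^bsub>E\<^esub> pr2 X)"
  by (simp add: internal_functor_def)

lemma internal_functor_composable:
  assumes "internal_cat E X" "internal_cat E Y" "internal_functor E X Y h" "composable E X f g"
  shows "composable E Y (snd h \<cdot>\<^bsub>E\<^esub> f) (snd h \<cdot>\<^bsub>E\<^esub> g)"
proof -
  interpret X: internal_cat E X by fact
  interpret Y: internal_cat E Y by fact
  note h [simp] = internal_functor_arr(1-6)[OF assms(3)]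
  note fg [simp] = assms(4)[unfolded composable_iff]
  have "d1 Y \<cdot>\<^bsub>E\<^esub> (snd h \<cdot>\<^bsub>E\<^esub> f) = fst h \<cdot>\<^bsub>E\<^esub> (d1 X \<cdot>\<^bsub>E\<^esub> f)"
    by (rule X.comp_eq_extend) (simp_all add: internal_functor_arr[OF assms(3)])
  moreover have "d0 Y \<cdot>\<^bsub>E\<^esub> (snd h \<cdot>\<^bsub>E\<^esub> g) = fst h \<cdot>\<^bsub>E\<^esub> (d0 X \<cdot>\<^bsub>E\<^esub> g)"
    by (rule X.comp_eq_extend) (simp_all add: internal_functor_arr[OF assms(3)])
  ultimately show ?thesis by (simp add: composable_iff)
qed

text \<open>The definition of an internal functor speaks of the generic pair
  \<open>(pr1 X, pr2 X)\<close> only. Every composable pair factors through it, and naturality of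
  composition does the rest.\<close>

lemma internal_functor_icomp:
  assumes "internal_cat E X" "internal_cat E Y" "internal_functor E X Y h" "composable E X f g"
  shows "snd h \<cdot>\<^bsub>E\<^esub> icomp E X f g = icomp E Y (snd h \<cdot>\<^bsub>E\<^esub> f) (snd h \<cdot>\<^bsub>E\<^esub> g)"
proof -
  interpret X: internal_cat E X by fact
  interpret Y: internal_cat E Y by fact
  note [simp] = internal_functor_arr(1-6)[OF assms(3)] X.lift_pr[OF assms(4)]
  let ?l = "lift E (pr1 X) (pr2 X) f g"
  have "snd h \<cdot>\<^bsub>E\<^esub> icomp E X f g = (snd h \<cdot>\<^bsub>E\<^esub> mult X) \<cdot>\<^bsub>E\<^esub> ?l"
    by (simp add: X.icomp_eq_lift X.comp_assoc)
  also have "snd h \<cdot>\<^bsub>E\<^esub> mult X = icomp E Y (snd h \<cdot>\<^bsub>E\<^esub> pr1 X) (snd h \<cdot>\<^bsub>E\<^esub> pr2 X)"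
    by (rule internal_functor_mult[OF assms(3)])
  also have "\<dots> \<cdot>\<^bsub>E\<^esub> ?l = icomp E Y ((snd h \<cdot>\<^bsub>E\<^esub> pr1 X) \<cdot>\<^bsub>E\<^esub> ?l) ((snd h \<cdot>\<^bsub>E\<^esub> pr2 X) \<cdot>\<^bsub>E\<^esub> ?l)"
    by (rule Y.icomp_comp[symmetric])
      (simp_all add: internal_functor_composable[OF assms(1-3) X.composable_pr])
  finally show ?thesis by (simp add: X.comp_assoc)
qed

lemma internal_functor_id:
  assumes "internal_cat E X"
  shows "internal_functor E X X (ifun_id E X)"
proof -
  interpret internal_cat E X by fact
  show ?thesis by (simp add: internal_functor_def ifun_id_def hom_iff icomp_pr)
qed

lemma internal_functor_comp:
  assumes "internal_cat E X" "internal_cat E Y" "internal_cat E Z"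
    and f: "internal_functor E X Y f" and g: "internal_functor E Y Z g"
  shows "internal_functor E X Z (ifun_comp E g f)"
proof -
  interpret X: internal_cat E X by fact
  interpret Y: internal_cat E Y by fact
  interpret Z: internal_cat E Z by fact
  note [simp] = internal_functor_arr(1-6)[OF f] internal_functor_arr(1-6)[OF g]
  note ff = internal_functor_arr(7-9)[OF f] and gg = internal_functor_arr(7-9)[OF g]
  have "d0 Z \<cdot>\<^bsub>E\<^esub> (snd g \<cdot>\<^bsub>E\<^esub> snd f) = (fst g \<cdot>\<^bsub>E\<^esub> fst f) \<cdot>\<^bsub>E\<^esub> d0 X"
    using X.comp_eq_extend[OF gg(1), of "snd f"] ff by (simp add: X.comp_assoc)
  moreover have "d1 Z \<cdot>\<^bsub>E\<^esub> (snd g \<cdot>\<^bsub>E\<^esub> snd f) = (fst g \<cdot>\<^bsub>E\<^esub> fst f) \<cdot>\<^bsub>E\<^esub> d1 X"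
    using X.comp_eq_extend[OF gg(2), of "snd f"] ff by (simp add: X.comp_assoc)
  moreover have "s0 Z \<cdot>\<^bsub>E\<^esub> (fst g \<cdot>\<^bsub>E\<^esub> fst f) = (snd g \<cdot>\<^bsub>E\<^esub> snd f) \<cdot>\<^bsub>E\<^esub> s0 X"
    using X.comp_eq_extend[OF gg(3), of "fst f"] ff by (simp add: X.comp_assoc)
  moreover have "(snd g \<cdot>\<^bsub>E\<^esub> snd f) \<cdot>\<^bsub>E\<^esub> mult X =
      icomp E Z ((snd g \<cdot>\<^bsub>E\<^esub> snd f) \<cdot>\<^bsub>E\<^esub> pr1 X) ((snd g \<cdot>\<^bsub>E\<^esub> snd f) \<cdot>\<^bsub>E\<^esub> pr2 X)"
    using f internal_functor_icomp[OF assms(2,3) g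
        internal_functor_composable[OF assms(1,2) f X.composable_pr]]
    by (simp add: X.comp_assoc internal_functor_def)
  ultimately show ?thesis by (simp add: internal_functor_def ifun_comp_def hom_iff)
qed

section \<open>Categories of internal categories over a base\<close>

lemma over_cat_simps [simp]:
  "Obj (over_cat E D) = D"
  "(A, f, B) \<in> Arr (over_cat E D) \<longleftrightarrow> A \<in> D \<and> B \<in> D \<and> internal_functor E (fst A) (fst B) f \<and>
     ifun_comp E (snd B) f = snd A"
  "Dom (over_cat E D) (A, f, B) = A"
  "Cod (over_cat E D) (A, f, B) = B"
  "Id (over_cat E D) A = (A, ifun_id E (fst A), A)"
  "(B', g, C) \<cdot>\<^bsub>over_cat E D\<^esub> (A, f, B) = (A, ifun_comp E g f, C)"
  by (simp_all add: over_cat_def)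

lemma category_over_cat:
  assumes E: "category E"
    and D: "\<And>A. A \<in> D \<Longrightarrow> internal_category E (fst A) \<and> internal_functor E (fst A) Y (snd A)"
  shows "category (over_cat E D)"
proof -
  interpret category E by fact
  have ic: "internal_cat E (fst A)" and h: "internal_functor E (fst A) Y (snd A)" if "A \<in> D" for A
    using D[OF that] E by (auto simp: internal_cat_def internal_cat_axioms_def)
  note arr = internal_functor_arr
  have id: "ifun_comp E f (ifun_id E X) = f \<and> ifun_comp E (ifun_id E X') f = f"
    if "internal_functor E X X' f" for f X X'
    using arr[OF that] by (simp add: ifun_comp_def ifun_id_def)
  have assoc: "ifun_comp E (ifun_comp E h g) f = ifun_comp E h (ifun_comp E g f)"
    if "internal_functor E X X' f" "internal_functor E X' X'' g" "internal_functor E X'' W h"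
    for f g h X X' X'' W
    using arr[OF that(1)] arr[OF that(2)] arr[OF that(3)] by (simp add: ifun_comp_def comp_assoc)
  have comp: "internal_functor E (fst A) (fst C) (ifun_comp E g f)"
    if "A \<in> D" "B \<in> D" "C \<in> D" "internal_functor E (fst A) (fst B) f"
      "internal_functor E (fst B) (fst C) g" for A B C f g
    using that internal_functor_comp ic by blast
  let ?C = "over_cat E D"
  have Arr_iff: "k \<in> Arr ?C \<longleftrightarrow> (\<exists>A f B. k = (A, f, B) \<and> A \<in> D \<and> B \<in> D \<and>
      internal_functor E (fst A) (fst B) f \<and> ifun_comp E (snd B) f = snd A)" for k
    by (cases k) (simp add: over_cat_def)
  show ?thesis
  proof (rule categoryI)
    show "\<forall>f\<in>Arr ?C. Dom ?C f \<in> Obj ?C \<and> Cod ?C f \<in> Obj ?C"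
      by (rule ballI, unfold Arr_iff, elim exE conjE) simp
  next
    show "\<forall>A\<in>Obj ?C. Id ?C A \<in> hom ?C A A"
      by (simp add: hom_iff internal_functor_id ic id[OF h])
  next
    show "\<forall>f\<in>Arr ?C. \<forall>g\<in>Arr ?C. Cod ?C f = Dom ?C g \<longrightarrow> g \<cdot>\<^bsub>?C\<^esub> f \<in> hom ?C (Dom ?C f) (Cod ?C g)"
    proof (intro ballI impI)
      fix k l assume "k \<in> Arr ?C" "l \<in> Arr ?C" and eq: "Cod ?C k = Dom ?C l"
      then obtain A f B B' g C where k: "k = (A, f, B)" "A \<in> D" "B \<in> D"
        "internal_functor E (fst A) (fst B) f" "ifun_comp E (snd B) f = snd A"
        and l: "l = (B', g, C)" "C \<in> D" "internal_functor E (fst B') (fst C) g"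
        "ifun_comp E (snd C) g = snd B'"
        unfolding Arr_iff by (elim exE conjE)
      have "B' = B" using eq k(1) l(1) by simp
      \<comment> \<open>Associativity with the structure functor \<open>snd C\<close> as the last
        factor shows that the composite again lies over \<open>Y\<close>.\<close>
      then show "l \<cdot>\<^bsub>?C\<^esub> k \<in> hom ?C (Dom ?C k) (Cod ?C l)"
        using k l comp[of A B C f g] assoc[OF k(4), of "fst C" g Y "snd C"] h[of C]
        by (simp add: hom_iff)
    qed
  next
    show "\<forall>f\<in>Arr ?C. f \<cdot>\<^bsub>?C\<^esub> Id ?C (Dom ?C f) = f \<and> Id ?C (Cod ?C f) \<cdot>\<^bsub>?C\<^esub> f = f"
      by (rule ballI, unfold Arr_iff, elim exE conjE) (simp add: id)
  next
    show "\<forall>f\<in>Arr ?C. \<forall>g\<in>Arr ?C. \<forall>h\<in>Arr ?C.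
      Cod ?C f = Dom ?C g \<and> Cod ?C g = Dom ?C h \<longrightarrow> (h \<cdot>\<^bsub>?C\<^esub> g) \<cdot>\<^bsub>?C\<^esub> f = h \<cdot>\<^bsub>?C\<^esub> (g \<cdot>\<^bsub>?C\<^esub> f)"
    proof (intro ballI impI)
      fix k l m assume "k \<in> Arr ?C" "l \<in> Arr ?C" "m \<in> Arr ?C"
        and eq: "Cod ?C k = Dom ?C l \<and> Cod ?C l = Dom ?C m"
      then obtain A f B B' g C C' e D' where
        k: "k = (A, f, B)" "internal_functor E (fst A) (fst B) f"
        and l: "l = (B', g, C)" "internal_functor E (fst B') (fst C) g"
        and m: "m = (C', e, D')" "internal_functor E (fst C') (fst D') e"
        unfolding Arr_iff by (elim exE conjE)
      have "B' = B" "C' = C" using eq k(1) l(1) m(1) by simp_all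
      then show "(m \<cdot>\<^bsub>?C\<^esub> l) \<cdot>\<^bsub>?C\<^esub> k = m \<cdot>\<^bsub>?C\<^esub> (l \<cdot>\<^bsub>?C\<^esub> k)"
        using assoc[OF k(2), of "fst C" g "fst D'" e] k l m by simp
    qed
  qed
qed

section \<open>Discrete fibrations as actions\<close>

text \<open>Instead of an arrow defined on a pullback, an action is a natural operation \<open>act x f\<close> on generalized
  elements \<open>x\<close> and \<open>f\<close> such that the codomain of \<open>f\<close> is the image of \<open>x\<close>, as \<open>actable\<close> requires.\<close>

definition actable :: "('o, 'm) cat \<Rightarrow> ('o, 'm) icat \<Rightarrow> 'm \<Rightarrow> 'm \<Rightarrow> 'm \<Rightarrow> bool" where
  "actable E Y a x f \<longleftrightarrow> x \<in> Arr E \<and> f \<in> Arr E \<and> Dom E f = Dom E x \<and> Cod E x = Dom E a \<and>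
     Cod E f = ob1 Y \<and> d1 Y \<cdot>\<^bsub>E\<^esub> f = a \<cdot>\<^bsub>E\<^esub> x"

text \<open>An internal presheaf: \<open>f\<close> carries an element over its codomain to one over
  its domain. Hence the composite of \<open>f\<close> followed by \<open>g\<close> acts by
  \<open>g\<close> before \<open>f\<close>, which is the order in \<open>act_icomp\<close>. The
  naturality \<open>act_comp\<close> makes the operation equivalent to an arrow on a
  pullback.\<close>

locale right_action = internal_cat E Y for E :: "('o, 'm) cat" (structure) and Y :: "('o, 'm) icat" +
  fixes a :: 'm and act :: "'m \<Rightarrow> 'm \<Rightarrow> 'm"
  assumes a_arr [simp]: "a \<in> Arr E" "Cod E a = ob0 Y"
    and act_arr: "actable E Y a x f \<Longrightarrow> act x f \<in> hom E (Dom E x) (Dom E a)"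
    and a_act: "actable E Y a x f \<Longrightarrow> a \<cdot> act x f = d0 Y \<cdot> f"
    and act_comp: "actable E Y a x f \<Longrightarrow> u \<in> Arr E \<Longrightarrow> Cod E u = Dom E x \<Longrightarrow>
      act (x \<cdot> u) (f \<cdot> u) = act x f \<cdot> u"
    and act_unit: "x \<in> Arr E \<Longrightarrow> Cod E x = Dom E a \<Longrightarrow> act x (s0 Y \<cdot> (a \<cdot> x)) = x"
    and act_icomp: "actable E Y a x g \<Longrightarrow> composable E Y f g \<Longrightarrow>
      act (act x g) f = act x (icomp E Y f g)"
begin

lemma act_arr':
  assumes "actable E Y a x f"
  shows "act x f \<in> Arr E" "Dom E (act x f) = Dom E x" "Cod E (act x f) = Dom E a"
  using act_arr[OF assms] by (auto simp: hom_iff)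

end

text \<open>An arrow \<open>f\<close> of \<open>Y\<close> that ends at the image of \<open>x\<close>
  has exactly one lift to \<open>X\<close> that ends at \<open>x\<close>; the action returns the
  domain of this lift.\<close>

definition difib_act :: "('o, 'm) cat \<Rightarrow> ('o, 'm) icat \<Rightarrow> 'm \<times> 'm \<Rightarrow> 'm \<Rightarrow> 'm \<Rightarrow> 'm" where
  "difib_act E X h x f = d0 X \<cdot>\<^bsub>E\<^esub> lift E (snd h) (d1 X) f x"

locale difib = X: internal_cat E X + Y: internal_cat E Y
  for E :: "('o, 'm) cat" (structure) and X Y :: "('o, 'm) icat" +
  fixes h :: "'m \<times> 'm"
  assumes difib: "discrete_fibration E X Y h"
begin

lemma h_functor: "internal_functor E X Y h"
  and pb_h: "is_pullback E (d1 Y) (fst h) (snd h) (d1 X)"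
  using difib by (auto simp: discrete_fibration_def)

lemmas functor_arr [simp] = internal_functor_arr(1-6)[OF h_functor]
lemmas functor_eq = internal_functor_arr(7-9)[OF h_functor]

abbreviation "the_lift x f \<equiv> lift E (snd h) (d1 X) f x"

lemma the_lift_works:
  assumes "actable E Y (fst h) x f"
  shows "the_lift x f \<in> Arr E" "Dom E (the_lift x f) = Dom E x" "Cod E (the_lift x f) = ob1 X"
    "snd h \<cdot> the_lift x f = f" "d1 X \<cdot> the_lift x f = x"
  using X.lift_works[OF pb_h, of f x] assms by (auto simp: actable_def)

lemma the_lift_eqI:
  assumes "u \<in> Arr E" "Cod E u = ob1 X" "snd h \<cdot> u = f" "d1 X \<cdot> u = x"
  shows "the_lift x f = u"
  using X.lift_eqI[OF pb_h, of u f x] assms by simp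

lemma the_lift_self: "the_lift (d1 X) (snd h) = Id E (ob1 X)"
  by (rule the_lift_eqI) simp_all

text \<open>Each law comes from uniqueness of lifts: an identity of \<open>X\<close> is the lift of
  an identity of \<open>Y\<close>, and the composite of two successive lifts is the lift of the
  composite.\<close>

lemma right_action_difib_act: "right_action E Y (fst h) (difib_act E X h)"
proof unfold_locales
  fix x f assume xf: "actable E Y (fst h) x f"
  note [simp] = the_lift_works[OF xf]
  show "difib_act E X h x f \<in> hom E (Dom E x) (Dom E (fst h))"
    by (simp add: difib_act_def hom_iff)
  show "fst h \<cdot> difib_act E X h x f = d0 Y \<cdot> f"
    using X.comp_eq_extend[OF functor_eq(1), of "the_lift x f"] by (simp add: difib_act_def)
  fix u assume u: "u \<in> Arr E" "Cod E u = Dom E x"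
  have "the_lift (x \<cdot> u) (f \<cdot> u) = the_lift x f \<cdot> u"
    by (rule X.lift_comp[OF pb_h]) (use xf u in \<open>auto simp: actable_def\<close>)
  then show "difib_act E X h (x \<cdot> u) (f \<cdot> u) = difib_act E X h x f \<cdot> u"
    using u by (simp add: difib_act_def X.comp_assoc)
next
  fix x assume x: "x \<in> Arr E" "Cod E x = Dom E (fst h)"
  have "the_lift x (s0 Y \<cdot> (fst h \<cdot> x)) = s0 X \<cdot> x"
    using x X.comp_eq_extend[OF functor_eq(3), of x] by (intro the_lift_eqI) simp_all
  then show "difib_act E X h x (s0 Y \<cdot> (fst h \<cdot> x)) = x"
    using x by (simp add: difib_act_def)
next
  fix x g f assume xg: "actable E Y (fst h) x g" and fg: "composable E Y f g"
  let ?y = "difib_act E X h x g"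
  let ?g = "the_lift x g" let ?f = "the_lift ?y f"
  note g [simp] = the_lift_works[OF xg]
  have "fst h \<cdot> ?y = d0 Y \<cdot> g"
    using X.comp_eq_extend[OF functor_eq(1), of ?g] by (simp add: difib_act_def)
  then have yf: "actable E Y (fst h) ?y f"
    using fg xg by (auto simp: actable_def composable_iff difib_act_def)
  note f [simp] = the_lift_works[OF yf]
  have c: "composable E X ?f ?g"
    by (simp add: composable_iff) (simp add: difib_act_def)
  have "the_lift x (icomp E Y f g) = icomp E X ?f ?g"
    by (rule the_lift_eqI)
      (simp_all add: X.icomp_arr[OF c] internal_functor_icomp[OF X.internal_cat_axioms Y.internal_cat_axioms h_functor c])
  then show "difib_act E X h ?y f = difib_act E X h x (icomp E Y f g)"
    by (simp add: difib_act_def X.icomp_arr[OF c, unfolded difib_act_def])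
qed simp_all

end

section \<open>The category of elements of an action\<close>

context right_action
begin

text \<open>This is the Grothendieck construction. An arrow is a pair of an arrow \<open>f\<close>
  of \<open>Y\<close> and an element \<open>x\<close> over its codomain; it runs from
  \<open>act x f\<close> to \<open>x\<close>. Identities pair an identity of \<open>Y\<close> with
  \<open>x\<close>, and a composite composes in \<open>Y\<close> and keeps the element of the second
  factor.\<close>

lemma realized_by_difib:
  assumes "finitely_complete E"
  obtains X h where "internal_category E X" "discrete_fibration E X Y h" "ob0 X = Dom E a" "fst h = a"
    "\<And>x f. actable E Y a x f \<Longrightarrow> difib_act E X h x f = act x f"
proof -
  obtain p q where P: "is_pullback E (d1 Y) a p q"
    by (rule pullback_exists[OF category_axioms assms, of "d1 Y" a]) simp_all
  note [simp] = pullback_arr(3,4,6-8)[OF P]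
  \<comment> \<open>The projections are the generic actable pair, so by naturality the single arrow
    \<open>act q p\<close> encodes the whole action; it becomes the domain map.\<close>
  have pq: "actable E Y a q p" by (simp add: actable_def pullback_arr[OF P])
  note [simp] = act_arr'[OF pq]
  have P_eqI: "u = v" if "u \<in> Arr E" "Cod E u = Dom E p" "v \<in> Arr E" "Cod E v = Dom E p"
    "Dom E u = Dom E v" "p \<cdot> u = p \<cdot> v" "q \<cdot> u = q \<cdot> v" for u v
    using pullback_eqI[OF P] that by blast
  have P_eq: "d1 Y \<cdot> (p \<cdot> u) = a \<cdot> (q \<cdot> u)" if "u \<in> Arr E" "Cod E u = Dom E p" for u
    by (rule comp_eq_extend) (simp_all add: pullback_arr[OF P] that)
  have aact: "a \<cdot> (act q p \<cdot> u) = d0 Y \<cdot> (p \<cdot> u)" if "u \<in> Arr E" "Cod E u = Dom E p" for u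
    by (rule comp_eq_extend) (simp_all add: a_act[OF pq] that)
  obtain r1 r2 where R: "is_pullback E q (act q p) r1 r2"
    by (rule pullback_exists[OF category_axioms assms, of q "act q p"]) simp_all
  note [simp] = pullback_arr(3,4,6-8)[OF R]
  define X where "X = \<lparr>ob0 = Dom E a, ob1 = Dom E p, ob2 = Dom E r1, d0 = act q p, d1 = q,
    s0 = lift E p q (s0 Y \<cdot> a) (Id E (Dom E a)), pr1 = r1, pr2 = r2,
    mult = lift E p q (icomp E Y (p \<cdot> r1) (p \<cdot> r2)) (q \<cdot> r2)\<rparr>"
  have X_sel [simp]: "ob0 X = Dom E a" "ob1 X = Dom E p" "ob2 X = Dom E r1" "d0 X = act q p"
    "d1 X = q" "pr1 X = r1" "pr2 X = r2"
    by (simp_all add: X_def)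
  have pcomp: "composable E Y (p \<cdot> f) (p \<cdot> g)" if "composable E X f g" for f g
    using that aact[of g] P_eq[of f] by (auto simp: composable_iff)
  have "a \<cdot> Id E (Dom E a) = d1 Y \<cdot> (s0 Y \<cdot> a)" by simp
  note s = lift_works[OF P _ _ _ _ _ this[symmetric]]
  have s0X [simp]: "s0 X \<in> Arr E" "Dom E (s0 X) = Dom E a" "Cod E (s0 X) = Dom E p"
    "p \<cdot> s0 X = s0 Y \<cdot> a" "q \<cdot> s0 X = Id E (Dom E a)"
    using s by (simp_all add: X_def)
  have pr: "composable E X r1 r2" using pullback_arr(9)[OF R] by (auto simp: composable_iff)
  note ic = icomp_arr[OF pcomp[OF pr]]
  have "d1 Y \<cdot> icomp E Y (p \<cdot> r1) (p \<cdot> r2) = a \<cdot> (q \<cdot> r2)"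
    by (simp add: ic P_eq)
  note m = lift_works[OF P _ _ _ _ _ this]
  have mX [simp]: "mult X \<in> Arr E" "Dom E (mult X) = Dom E r1" "Cod E (mult X) = Dom E p"
    "p \<cdot> mult X = icomp E Y (p \<cdot> r1) (p \<cdot> r2)" "q \<cdot> mult X = q \<cdot> r2"
    using m by (simp_all add: X_def ic)
  have pairing: "icomp E X f g \<in> Arr E" "Dom E (icomp E X f g) = Dom E f"
    "Cod E (icomp E X f g) = Dom E p"
    "p \<cdot> icomp E X f g = icomp E Y (p \<cdot> f) (p \<cdot> g)" "q \<cdot> icomp E X f g = q \<cdot> g"
    if fg: "composable E X f g" for f g
  proof -
    let ?l = "lift E r1 r2 f g"
    have l [simp]: "?l \<in> Arr E" "Dom E ?l = Dom E f" "Cod E ?l = Dom E r1" "r1 \<cdot> ?l = f" "r2 \<cdot> ?l = g"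
      using lift_works[OF R, of f g] fg by (auto simp: composable_iff)
    have eq: "icomp E X f g = mult X \<cdot> ?l" by (simp add: icomp_lift)
    show "icomp E X f g \<in> Arr E" "Dom E (icomp E X f g) = Dom E f" "Cod E (icomp E X f g) = Dom E p"
      by (simp_all add: eq)
    have "p \<cdot> icomp E X f g = icomp E Y (p \<cdot> r1) (p \<cdot> r2) \<cdot> ?l"
      unfolding eq by (rule comp_eq_extend1) simp_all
    also have "\<dots> = icomp E Y ((p \<cdot> r1) \<cdot> ?l) ((p \<cdot> r2) \<cdot> ?l)"
      by (rule icomp_comp[symmetric]) (simp_all add: pcomp[OF pr])
    finally show "p \<cdot> icomp E X f g = icomp E Y (p \<cdot> f) (p \<cdot> g)" by (simp add: comp_assoc)
    show "q \<cdot> icomp E X f g = q \<cdot> g"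
      using comp_eq_extend[OF mX(5), of ?l] by (simp add: eq)
  qed
  \<comment> \<open>The domain equation for composites is the law \<open>act_icomp\<close>,
    evaluated on the two arrows of \<open>Y\<close> and on the element
    \<open>q \<cdot> g\<close>.\<close>
  have d0_icomp: "act q p \<cdot> icomp E X f g = act q p \<cdot> f" if fg: "composable E X f g" for f g
  proof -
    have fg' [simp]: "f \<in> Arr E" "g \<in> Arr E" "Dom E g = Dom E f" "Cod E f = Dom E p" "Cod E g = Dom E p"
      and dd: "q \<cdot> f = act q p \<cdot> g"
      using fg by (auto simp: composable_iff)
    have qg: "actable E Y a (q \<cdot> g) (p \<cdot> g)" by (simp add: actable_def P_eq)
    have "act q p \<cdot> icomp E X f g = act (q \<cdot> icomp E X f g) (p \<cdot> icomp E X f g)"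
      by (rule act_comp[symmetric, OF pq]) (simp_all add: pairing[OF fg])
    also have "\<dots> = act (act (q \<cdot> g) (p \<cdot> g)) (p \<cdot> f)"
      by (simp add: pairing[OF fg] act_icomp[OF qg pcomp[OF fg]])
    also have "act (q \<cdot> g) (p \<cdot> g) = q \<cdot> f"
      by (subst act_comp[OF pq]) (simp_all add: dd)
    also have "act (q \<cdot> f) (p \<cdot> f) = act q p \<cdot> f"
      by (rule act_comp[OF pq]) simp_all
    finally show ?thesis .
  qed
  have comps: "f \<in> Arr E" "g \<in> Arr E" "Dom E g = Dom E f" "Cod E f = Dom E p" "Cod E g = Dom E p"
    "q \<cdot> f = act q p \<cdot> g"
    if "composable E X f g" for f g
    using that by (auto simp: composable_iff)
  have icX: "icomp E X r1 r2 = mult X"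
  proof -
    have "lift E r1 r2 r1 r2 = Id E (Dom E r1)" by (rule lift_eqI[OF R]) simp_all
    then show ?thesis by (simp add: icomp_lift)
  qed
  \<comment> \<open>The domain equation for identities is the unit law of the action.\<close>
  have d0s: "act q p \<cdot> (s0 X \<cdot> x) = x" if x [simp]: "x \<in> Arr E" "Cod E x = Dom E a" for x
  proof -
    have "p \<cdot> (s0 X \<cdot> x) = s0 Y \<cdot> (a \<cdot> x)" by (rule comp_eq_extend) simp_all
    moreover have "q \<cdot> (s0 X \<cdot> x) = x" by (simp add: comp_eq_extend1[OF s0X(5)])
    ultimately show ?thesis
      using act_comp[OF pq, of "s0 X \<cdot> x"] act_unit[OF x] by simp
  qed
  have icat: "internal_category E X"
    unfolding internal_category_def
  proof (intro conjI allI ballI impI)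
    show "d0 X \<cdot> s0 X = Id E (ob0 X)" using d0s[of "Id E (Dom E a)"] by simp
    show "is_pullback E (d1 X) (d0 X) (pr1 X) (pr2 X)" using R by simp
    show "d0 X \<cdot> mult X = d0 X \<cdot> pr1 X" using d0_icomp[OF pr] by (simp add: icX)
  next
    fix U f assume "f \<in> hom E U (ob1 X)"
    then have f [simp]: "f \<in> Arr E" "Cod E f = Dom E p" by (auto simp: hom_iff)
    have ps: "p \<cdot> (s0 X \<cdot> x) = s0 Y \<cdot> (a \<cdot> x)" and qs: "q \<cdot> (s0 X \<cdot> x) = x"
      if "x \<in> Arr E" "Cod E x = Dom E a" for x
      using that comp_eq_extend[OF s0X(4), of x] comp_eq_extend1[OF s0X(5), of x] by simp_all
    have l: "composable E X (s0 X \<cdot> (act q p \<cdot> f)) f" and r: "composable E X f (s0 X \<cdot> (q \<cdot> f))"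
      using d0s[of "q \<cdot> f"] qs[of "act q p \<cdot> f"] by (simp_all add: composable_iff)
    show "icomp E X (s0 X \<cdot> (d0 X \<cdot> f)) f = f"
      unfolding X_sel by (rule P_eqI) (simp_all add: pairing[OF l] ps aact icomp_unit)
    show "icomp E X f (s0 X \<cdot> (d1 X \<cdot> f)) = f"
      unfolding X_sel by (rule P_eqI) (simp_all add: pairing[OF r] ps qs icomp_unit flip: P_eq)
  next
    fix f g k assume "composable E X f g \<and> composable E X g k"
    then have fg: "composable E X f g" and gk: "composable E X g k" by auto
    have 1: "composable E X (icomp E X f g) k" and 2: "composable E X f (icomp E X g k)"
      using comps[OF fg] comps[OF gk]
      by (auto simp: composable_iff pairing[OF fg] pairing[OF gk] d0_icomp[OF gk])
    show "icomp E X (icomp E X f g) k = icomp E X f (icomp E X g k)"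
      by (rule P_eqI)
        (simp_all add: pairing[OF fg] pairing[OF gk] pairing[OF 1] pairing[OF 2]
          icomp_assoc[OF pcomp[OF fg] pcomp[OF gk]])
  qed (simp_all add: hom_iff)
  have fib: "discrete_fibration E X Y (a, p)"
    using P by (simp add: discrete_fibration_def internal_functor_def hom_iff a_act[OF pq]
        pullback_arr(9)[OF P])
  have "difib_act E X (a, p) x f = act x f" if xf: "actable E Y a x f" for x f
  proof -
    have "lift E p q f x \<in> Arr E" "Cod E (lift E p q f x) = Dom E p" "p \<cdot> lift E p q f x = f"
      "q \<cdot> lift E p q f x = x"
      using lift_works[OF P, of f x] xf by (auto simp: actable_def)
    then show ?thesis
      using act_comp[OF pq, of "lift E p q f x"] by (simp add: difib_act_def)
  qed
  then show ?thesis using that[OF icat fib] by simp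
qed

end

text \<open>A functor over \<open>Y\<close> maps the lift of \<open>f\<close> that ends at
  \<open>x\<close> to a lift of \<open>f\<close> that ends at the image of \<open>x\<close>, and
  there is only one.\<close>

lemma difib_functor_equivariant:
  assumes "difib E X Y h" "difib E X' Y h'" and k: "internal_functor E X X' k"
    and kh: "ifun_comp E h' k = h" and xf: "actable E Y (fst h) x f"
  shows "fst k \<cdot>\<^bsub>E\<^esub> difib_act E X h x f = difib_act E X' h' (fst k \<cdot>\<^bsub>E\<^esub> x) f"
proof -
  interpret X: difib E X Y h by fact
  interpret X': difib E X' Y h' by fact
  note [simp] = internal_functor_arr(1-6)[OF k] X.the_lift_works[OF xf]
  note k_eq = internal_functor_arr(7,8)[OF k]
  have h: "snd h' \<cdot>\<^bsub>E\<^esub> snd k = snd h" using kh by (auto simp: ifun_comp_def)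
  have "X'.the_lift (fst k \<cdot>\<^bsub>E\<^esub> x) f = snd k \<cdot>\<^bsub>E\<^esub> X.the_lift x f"
    by (rule X'.the_lift_eqI)
      (simp_all add: X.X.comp_eq_extend1[OF h] X.X.comp_eq_extend[OF k_eq(2)])
  then show ?thesis
    by (simp add: difib_act_def X.X.comp_eq_extend[OF k_eq(1)])
qed

text \<open>The arrow part is determined by its composites with \<open>snd h'\<close> and
  \<open>d1 X'\<close>; the former is \<open>snd h\<close>, and the latter depends only on the
  object part.\<close>

lemma difib_functor_unique:
  assumes "difib E X' Y h'" and k: "internal_functor E X X' k" "internal_functor E X X' l"
    and kh: "ifun_comp E h' k = h" "ifun_comp E h' l = h" and eq: "fst k = fst l"
  shows "k = l"
proof -
  interpret X': difib E X' Y h' by fact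
  note [simp] = internal_functor_arr[OF k(1)] internal_functor_arr[OF k(2)]
  have "snd k = snd l"
    by (rule X'.X.pullback_eqI[OF X'.pb_h]) (use kh eq in \<open>auto simp: ifun_comp_def\<close>)
  then show ?thesis using eq by (simp add: prod_eq_iff)
qed

text \<open>The arrow part is forced: an arrow of \<open>X\<close> goes to the lift of its image in
  \<open>Y\<close> that ends at \<open>k\<close> of its codomain. As \<open>snd h'\<close> and
  \<open>d1 X'\<close> are jointly monic, compatibility with \<open>s0\<close> and
  \<open>mult\<close> is checked on these two projections.\<close>

lemma difib_functor_exists:
  assumes "difib E X Y h" "difib E X' Y h'" and k: "k \<in> hom E (ob0 X) (ob0 X')"
    and kh: "fst h' \<cdot>\<^bsub>E\<^esub> k = fst h"
    and equi: "\<And>x f. actable E Y (fst h) x f \<Longrightarrow>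
      k \<cdot>\<^bsub>E\<^esub> difib_act E X h x f = difib_act E X' h' (k \<cdot>\<^bsub>E\<^esub> x) f"
  obtains k1 where "internal_functor E X X' (k, k1)" "ifun_comp E h' (k, k1) = h"
proof -
  interpret X: difib E X Y h by fact
  interpret X': difib E X' Y h' by fact
  note [simp] = X.X.comp_assoc
  have [simp]: "k \<in> Arr E" "Dom E k = ob0 X" "Cod E k = ob0 X'" using k by (auto simp: hom_iff)
  have khx: "fst h' \<cdot>\<^bsub>E\<^esub> (k \<cdot>\<^bsub>E\<^esub> x) = fst h \<cdot>\<^bsub>E\<^esub> x" if "x \<in> Arr E" "Cod E x = ob0 X" for x
    using that by (simp flip: kh)
  have act: "actable E Y (fst h) (d1 X) (snd h)" by (simp add: actable_def X.functor_eq)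
  then have act': "actable E Y (fst h') (k \<cdot>\<^bsub>E\<^esub> d1 X) (snd h)" by (simp add: actable_def khx)
  define k1 where "k1 = X'.the_lift (k \<cdot>\<^bsub>E\<^esub> d1 X) (snd h)"
  have k1 [simp]: "k1 \<in> Arr E" "Dom E k1 = ob1 X" "Cod E k1 = ob1 X'"
    "snd h' \<cdot>\<^bsub>E\<^esub> k1 = snd h" "d1 X' \<cdot>\<^bsub>E\<^esub> k1 = k \<cdot>\<^bsub>E\<^esub> d1 X"
    using X'.the_lift_works[OF act'] by (simp_all add: k1_def)
  have hk1: "snd h' \<cdot>\<^bsub>E\<^esub> (k1 \<cdot>\<^bsub>E\<^esub> u) = snd h \<cdot>\<^bsub>E\<^esub> u" "d1 X' \<cdot>\<^bsub>E\<^esub> (k1 \<cdot>\<^bsub>E\<^esub> u) = k \<cdot>\<^bsub>E\<^esub> (d1 X \<cdot>\<^bsub>E\<^esub> u)"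
    if "u \<in> Arr E" "Cod E u = ob1 X" for u
    using that X.X.comp_eq_extend1[OF k1(4), of u] X.X.comp_eq_extend[OF k1(5), of u] by simp_all
  \<comment> \<open>The pair \<open>(d1 X, snd h)\<close> is the generic actable pair of
    \<open>X\<close>. Its lift is the identity, so it acts to give \<open>d0 X\<close>, and
    equivariance at this pair is compatibility with domains.\<close>
  have d0k: "d0 X' \<cdot>\<^bsub>E\<^esub> k1 = k \<cdot>\<^bsub>E\<^esub> d0 X"
    using equi[OF act] by (simp add: difib_act_def k1_def X.the_lift_self)
  have X'_eqI: "u = v" if "u \<in> Arr E" "Cod E u = ob1 X'" "v \<in> Arr E" "Cod E v = ob1 X'"
    "Dom E u = Dom E v" "snd h' \<cdot>\<^bsub>E\<^esub> u = snd h' \<cdot>\<^bsub>E\<^esub> v" "d1 X' \<cdot>\<^bsub>E\<^esub> u = d1 X' \<cdot>\<^bsub>E\<^esub> v" for u v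
    using X.X.pullback_eqI[OF X'.pb_h] that by simp
  have s: "s0 X' \<cdot>\<^bsub>E\<^esub> k = k1 \<cdot>\<^bsub>E\<^esub> s0 X"
  proof (rule X'_eqI)
    have "snd h' \<cdot>\<^bsub>E\<^esub> (s0 X' \<cdot>\<^bsub>E\<^esub> k) = s0 Y \<cdot>\<^bsub>E\<^esub> (fst h' \<cdot>\<^bsub>E\<^esub> k)"
      by (rule X.X.comp_eq_extend) (simp_all add: X'.functor_eq)
    then show "snd h' \<cdot>\<^bsub>E\<^esub> (s0 X' \<cdot>\<^bsub>E\<^esub> k) = snd h' \<cdot>\<^bsub>E\<^esub> (k1 \<cdot>\<^bsub>E\<^esub> s0 X)"
      by (simp add: hk1 kh X.functor_eq)
  qed (simp_all add: hk1)
  have "d1 X' \<cdot>\<^bsub>E\<^esub> (k1 \<cdot>\<^bsub>E\<^esub> pr1 X) = d0 X' \<cdot>\<^bsub>E\<^esub> (k1 \<cdot>\<^bsub>E\<^esub> pr2 X)"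
    using X.X.comp_eq_extend[OF d0k, of "pr2 X"] X.X.composable_pr by (simp add: hk1 composable_iff)
  then have pr: "composable E X' (k1 \<cdot>\<^bsub>E\<^esub> pr1 X) (k1 \<cdot>\<^bsub>E\<^esub> pr2 X)" by (simp add: composable_iff)
  note ic = X'.X.icomp_arr[OF pr]
  have m: "k1 \<cdot>\<^bsub>E\<^esub> mult X = icomp E X' (k1 \<cdot>\<^bsub>E\<^esub> pr1 X) (k1 \<cdot>\<^bsub>E\<^esub> pr2 X)"
  proof (rule X'_eqI)
    have "snd h \<cdot>\<^bsub>E\<^esub> mult X = icomp E Y (snd h \<cdot>\<^bsub>E\<^esub> pr1 X) (snd h \<cdot>\<^bsub>E\<^esub> pr2 X)"
      by (rule internal_functor_mult[OF X.h_functor])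
    moreover have "snd h' \<cdot>\<^bsub>E\<^esub> icomp E X' (k1 \<cdot>\<^bsub>E\<^esub> pr1 X) (k1 \<cdot>\<^bsub>E\<^esub> pr2 X) =
        icomp E Y (snd h' \<cdot>\<^bsub>E\<^esub> (k1 \<cdot>\<^bsub>E\<^esub> pr1 X)) (snd h' \<cdot>\<^bsub>E\<^esub> (k1 \<cdot>\<^bsub>E\<^esub> pr2 X))"
      by (rule internal_functor_icomp[OF X'.X.internal_cat_axioms X.Y.internal_cat_axioms X'.h_functor pr])
    ultimately show "snd h' \<cdot>\<^bsub>E\<^esub> (k1 \<cdot>\<^bsub>E\<^esub> mult X) =
        snd h' \<cdot>\<^bsub>E\<^esub> icomp E X' (k1 \<cdot>\<^bsub>E\<^esub> pr1 X) (k1 \<cdot>\<^bsub>E\<^esub> pr2 X)"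
      by (simp add: hk1)
    show "d1 X' \<cdot>\<^bsub>E\<^esub> (k1 \<cdot>\<^bsub>E\<^esub> mult X) =
        d1 X' \<cdot>\<^bsub>E\<^esub> icomp E X' (k1 \<cdot>\<^bsub>E\<^esub> pr1 X) (k1 \<cdot>\<^bsub>E\<^esub> pr2 X)"
      unfolding ic(5) by (simp add: hk1 X.X.d1_mult)
  qed (simp_all add: ic)
  have "internal_functor E X X' (k, k1)"
    using d0k s m by (simp add: internal_functor_def hom_iff)
  moreover have "ifun_comp E h' (k, k1) = h"
    by (simp add: ifun_comp_def kh)
  ultimately show ?thesis by (rule that)
qed

section \<open>Gumm categories of internal presheaves\<close>

text \<open>The category \<open>D\<close> is the category of actions of \<open>Y\<close> and equivariant maps up to equivalence, not on
  the nose: a discrete fibration involves chosen pullbacks which its action does not determine.\<close>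

locale presheaf_category = internal_cat E Y + D: category D
  for E :: "('o, 'm) cat" (structure) and Y :: "('o, 'm) icat" and D :: "('a, 'b) cat" +
  fixes U0 :: "'a \<Rightarrow> 'o" and U1 :: "'b \<Rightarrow> 'm" and b :: "'a \<Rightarrow> 'm" and act :: "'a \<Rightarrow> 'm \<Rightarrow> 'm \<Rightarrow> 'm"
  assumes fin_complete: "finitely_complete E"
    and U_functor: "is_functor D E U0 U1"
    and action: "A \<in> Obj D \<Longrightarrow> right_action E Y (b A) (act A)"
    and Dom_b [simp]: "A \<in> Obj D \<Longrightarrow> Dom E (b A) = U0 A"
    and b_nat: "k \<in> Arr D \<Longrightarrow> b (Cod D k) \<cdot> U1 k = b (Dom D k)"
    and equivariant: "k \<in> Arr D \<Longrightarrow> actable E Y (b (Dom D k)) x f \<Longrightarrow>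
      U1 k \<cdot> act (Dom D k) x f = act (Cod D k) (U1 k \<cdot> x) f"
    and faithful: "k \<in> hom D A B \<Longrightarrow> l \<in> hom D A B \<Longrightarrow> U1 k = U1 l \<Longrightarrow> k = l"
    and full: "A \<in> Obj D \<Longrightarrow> B \<in> Obj D \<Longrightarrow> u \<in> hom E (U0 A) (U0 B) \<Longrightarrow> b B \<cdot> u = b A \<Longrightarrow>
      (\<And>x f. actable E Y (b A) x f \<Longrightarrow> u \<cdot> act A x f = act B (u \<cdot> x) f) \<Longrightarrow>
      \<exists>k \<in> hom D A B. U1 k = u"
    and realize: "right_action E Y a \<alpha> \<Longrightarrow>
      \<exists>A \<in> Obj D. b A = a \<and> (\<forall>x f. actable E Y a x f \<longrightarrow> act A x f = \<alpha> x f)"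
begin

lemma U1_arr [simp]:
  assumes "k \<in> Arr D"
  shows "U1 k \<in> Arr E" "Dom E (U1 k) = U0 (Dom D k)" "Cod E (U1 k) = U0 (Cod D k)"
  using U_functor assms by (auto simp: is_functor_def hom_iff)

lemma U0_Obj [simp]: "A \<in> Obj D \<Longrightarrow> U0 A \<in> Obj E"
  using U_functor by (auto simp: is_functor_def)

lemma U1_Id: "A \<in> Obj D \<Longrightarrow> U1 (Id D A) = Id E (U0 A)"
  using U_functor by (auto simp: is_functor_def)

lemma U1_comp [simp]:
  "k \<in> Arr D \<Longrightarrow> l \<in> Arr D \<Longrightarrow> Cod D k = Dom D l \<Longrightarrow> U1 (l \<cdot>\<^bsub>D\<^esub> k) = U1 l \<cdot> U1 k"
  using U_functor by (auto simp: is_functor_def)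

lemma b_arr [simp]: "A \<in> Obj D \<Longrightarrow> b A \<in> Arr E" "A \<in> Obj D \<Longrightarrow> Cod E (b A) = ob0 Y"
  using right_action.a_arr[OF action] by auto

lemma b_nat_elt:
  assumes "k \<in> Arr D" "u \<in> Arr E" "Cod E u = U0 (Dom D k)"
  shows "b (Cod D k) \<cdot> (U1 k \<cdot> u) = b (Dom D k) \<cdot> u"
  by (rule comp_eq_extend1[OF b_nat]) (use assms in simp_all)

lemmas act_arr = right_action.act_arr'[OF action]
lemmas b_act = right_action.a_act[OF action]
lemmas act_comp = right_action.act_comp[OF action]
lemmas act_unit = right_action.act_unit[OF action]
lemmas act_icomp = right_action.act_icomp[OF action]

section \<open>Limits of actions\<close>

lemma D_finitely_complete: "finitely_complete D"
  unfolding finitely_complete_def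
proof (intro allI impI, elim conjE)
  fix J :: "(nat, nat) cat" and F0 F1
  assume J: "category J" "finite (Obj J)" "finite (Arr J)" and F: "is_functor J D F0 F1"
  interpret J: category J by fact
  have F0 [simp]: "F0 j \<in> Obj D" if "j \<in> Obj J" for j
    using F that by (auto simp: is_functor_def)
  have F1 [simp]: "F1 e \<in> Arr D" "Dom D (F1 e) = F0 (Dom J e)" "Cod D (F1 e) = F0 (Cod J e)"
    if "e \<in> Arr J" for e
    using F that by (auto simp: is_functor_def hom_iff)
  let ?G0 = "\<lambda>j. U0 (F0 j)" and ?G1 = "\<lambda>e. U1 (F1 e)"
  have G: "is_functor J E ?G0 ?G1"
    using F by (auto simp: is_functor_def hom_iff U1_Id)
  have "\<exists>L l c. c \<in> hom E L (ob0 Y) \<and> is_cone J E ?G0 ?G1 L l \<and> (\<forall>j\<in>Obj J. b (F0 j) \<cdot> l j = c) \<and>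
    (\<forall>M m e. e \<in> hom E M (ob0 Y) \<and> is_cone J E ?G0 ?G1 M m \<and> (\<forall>j\<in>Obj J. b (F0 j) \<cdot> m j = e) \<longrightarrow>
      (\<exists>!u. u \<in> hom E M L \<and> c \<cdot> u = e \<and> (\<forall>j\<in>Obj J. l j \<cdot> u = m j)))"
  proof (rule limit_over_exists[OF category_axioms fin_complete J G])
    show "ob0 Y \<in> Obj E" by simp
    show "b (F0 j) \<in> hom E (U0 (F0 j)) (ob0 Y)" if "j \<in> Obj J" for j
      using that by (simp add: hom_iff)
    show "b (F0 (Cod J e)) \<cdot> U1 (F1 e) = b (F0 (Dom J e))" if "e \<in> Arr J" for e
      using b_nat[of "F1 e"] that by simp
  qed
  then obtain L l c where c: "c \<in> hom E L (ob0 Y)" and cone: "is_cone J E ?G0 ?G1 L l"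
    and bl: "\<And>j. j \<in> Obj J \<Longrightarrow> b (F0 j) \<cdot> l j = c"
    and univ': "\<forall>M m e. e \<in> hom E M (ob0 Y) \<and> is_cone J E ?G0 ?G1 M m \<and>
      (\<forall>j\<in>Obj J. b (F0 j) \<cdot> m j = e) \<longrightarrow>
      (\<exists>!u. u \<in> hom E M L \<and> c \<cdot> u = e \<and> (\<forall>j\<in>Obj J. l j \<cdot> u = m j))"
    by (elim exE conjE) simp
  have univ: "\<exists>!u. u \<in> hom E M L \<and> c \<cdot> u = e \<and> (\<forall>j\<in>Obj J. l j \<cdot> u = m j)"
    if "e \<in> hom E M (ob0 Y)" "is_cone J E ?G0 ?G1 M m" "\<And>j. j \<in> Obj J \<Longrightarrow> b (F0 j) \<cdot> m j = e"
    for M m e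
    using univ' that by simp
  have c_arr [simp]: "c \<in> Arr E" "Dom E c = L" "Cod E c = ob0 Y"
    using c by (auto simp: hom_iff)
  have l_arr [simp]: "l j \<in> Arr E" "Dom E (l j) = L" "Cod E (l j) = U0 (F0 j)" if "j \<in> Obj J" for j
    using cone that by (auto simp: is_cone_def hom_iff)
  have l_nat: "U1 (F1 e) \<cdot> l (Dom J e) = l (Cod J e)" if "e \<in> Arr J" for e
    using cone that by (auto simp: is_cone_def)
  have l_nat_elt: "U1 (F1 e) \<cdot> (l (Dom J e) \<cdot> u) = l (Cod J e) \<cdot> u"
    if "e \<in> Arr J" "u \<in> Arr E" "Cod E u = L" for e u
    by (rule comp_eq_extend1[OF l_nat]) (use that in simp_all)
  have bl_elt: "b (F0 j) \<cdot> (l j \<cdot> u) = c \<cdot> u" if "j \<in> Obj J" "u \<in> Arr E" "Cod E u = L" for j u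
    by (rule comp_eq_extend1[OF bl]) (use that in simp_all)
  \<comment> \<open>Joint monicity of the legs together with \<open>c\<close>; every law of the
    induced action, and equivariance of the mediating arrow, is checked through it.\<close>
  have L_eqI: "u = v" if "u \<in> Arr E" "v \<in> Arr E" "Dom E u = Dom E v" "Cod E u = L" "Cod E v = L"
    "c \<cdot> u = c \<cdot> v" "\<And>j. j \<in> Obj J \<Longrightarrow> l j \<cdot> u = l j \<cdot> v" for u v
  proof -
    have "is_cone J E ?G0 ?G1 (Dom E v) (\<lambda>j. l j \<cdot> v)"
      using that(2,5) by (auto simp: is_cone_def hom_iff l_nat_elt)
    then have "\<exists>!w. w \<in> hom E (Dom E v) L \<and> c \<cdot> w = c \<cdot> v \<and> (\<forall>j\<in>Obj J. l j \<cdot> w = l j \<cdot> v)"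
      using that(2,5) by (intro univ) (auto simp: hom_iff bl_elt)
    moreover have "u \<in> hom E (Dom E v) L \<and> c \<cdot> u = c \<cdot> v \<and> (\<forall>j\<in>Obj J. l j \<cdot> u = l j \<cdot> v)"
      using that by (simp add: hom_iff)
    moreover have "v \<in> hom E (Dom E v) L \<and> c \<cdot> v = c \<cdot> v \<and> (\<forall>j\<in>Obj J. l j \<cdot> v = l j \<cdot> v)"
      using that(2,5) by (simp add: hom_iff)
    ultimately show ?thesis by blast
  qed
  \<comment> \<open>The action is componentwise: its value is the mediating arrow for the family of
    elements \<open>l j \<cdot> x\<close>, each acted on by \<open>f\<close>.\<close>
  define \<alpha> where "\<alpha> x f = (THE u. u \<in> hom E (Dom E x) L \<and> c \<cdot> u = d0 Y \<cdot> f \<and>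
    (\<forall>j\<in>Obj J. l j \<cdot> u = act (F0 j) (l j \<cdot> x) f))" for x f
  have actable_l: "actable E Y (b (F0 j)) (l j \<cdot> x) f"
    if "j \<in> Obj J" "actable E Y c x f" for j x f
    using that by (auto simp: actable_def bl_elt)
  have \<alpha>: "\<alpha> x f \<in> Arr E" "Dom E (\<alpha> x f) = Dom E x" "Cod E (\<alpha> x f) = L" "c \<cdot> \<alpha> x f = d0 Y \<cdot> f"
    "\<And>j. j \<in> Obj J \<Longrightarrow> l j \<cdot> \<alpha> x f = act (F0 j) (l j \<cdot> x) f"
    if xf: "actable E Y c x f" for x f
  proof -
    have xf' [simp]: "x \<in> Arr E" "f \<in> Arr E" "Dom E f = Dom E x" "Cod E x = L" "Cod E f = ob1 Y"
      using xf by (auto simp: actable_def)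
    \<comment> \<open>Equivariance of the transition arrows \<open>F1 e\<close> is what makes the
      acted family a cone again.\<close>
    have "is_cone J E ?G0 ?G1 (Dom E x) (\<lambda>j. act (F0 j) (l j \<cdot> x) f)"
      unfolding is_cone_def
    proof (intro conjI ballI)
      fix e assume e: "e \<in> Arr J"
      show "U1 (F1 e) \<cdot> act (F0 (Dom J e)) (l (Dom J e) \<cdot> x) f =
          act (F0 (Cod J e)) (l (Cod J e) \<cdot> x) f"
        using equivariant[of "F1 e" "l (Dom J e) \<cdot> x" f] e actable_l[OF _ xf]
        by (simp add: l_nat_elt)
    qed (simp_all add: hom_iff act_arr[OF _ actable_l[OF _ xf]])
    then have "\<exists>!u. u \<in> hom E (Dom E x) L \<and> c \<cdot> u = d0 Y \<cdot> f \<and>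
        (\<forall>j\<in>Obj J. l j \<cdot> u = act (F0 j) (l j \<cdot> x) f)"
      by (intro univ) (simp_all add: hom_iff b_act[OF _ actable_l[OF _ xf]])
    from theI'[OF this] show "\<alpha> x f \<in> Arr E" "Dom E (\<alpha> x f) = Dom E x" "Cod E (\<alpha> x f) = L"
      "c \<cdot> \<alpha> x f = d0 Y \<cdot> f" "\<And>j. j \<in> Obj J \<Longrightarrow> l j \<cdot> \<alpha> x f = act (F0 j) (l j \<cdot> x) f"
      by (auto simp: \<alpha>_def hom_iff)
  qed
  have "right_action E Y c \<alpha>"
  proof unfold_locales
    fix x f assume xf: "actable E Y c x f"
    then have xf' [simp]: "x \<in> Arr E" "f \<in> Arr E" "Dom E f = Dom E x" "Cod E x = L" "Cod E f = ob1 Y"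
      and eq: "d1 Y \<cdot> f = c \<cdot> x"
      by (auto simp: actable_def)
    show "\<alpha> x f \<in> hom E (Dom E x) (Dom E c)" "c \<cdot> \<alpha> x f = d0 Y \<cdot> f"
      using \<alpha>[OF xf] by (simp_all add: hom_iff)
    fix u assume u [simp]: "u \<in> Arr E" "Cod E u = Dom E x"
    have "d1 Y \<cdot> (f \<cdot> u) = c \<cdot> (x \<cdot> u)" by (rule comp_eq_extend[OF eq]) simp_all
    then have xfu: "actable E Y c (x \<cdot> u) (f \<cdot> u)" by (simp add: actable_def)
    show "\<alpha> (x \<cdot> u) (f \<cdot> u) = \<alpha> x f \<cdot> u"
    proof (rule L_eqI)
      show "c \<cdot> \<alpha> (x \<cdot> u) (f \<cdot> u) = c \<cdot> (\<alpha> x f \<cdot> u)"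
        using \<alpha>[OF xf] \<alpha>[OF xfu] comp_eq_extend[OF \<alpha>(4)[OF xf], of u] by simp
      fix j assume j: "j \<in> Obj J"
      have "l j \<cdot> (\<alpha> x f \<cdot> u) = act (F0 j) (l j \<cdot> x) f \<cdot> u"
        by (rule comp_eq_extend1[OF \<alpha>(5)[OF xf j]]) (use \<alpha>[OF xf] j in simp_all)
      also have "\<dots> = act (F0 j) ((l j \<cdot> x) \<cdot> u) (f \<cdot> u)"
        by (rule act_comp[symmetric, OF _ actable_l[OF j xf]]) (use j in simp_all)
      finally show "l j \<cdot> \<alpha> (x \<cdot> u) (f \<cdot> u) = l j \<cdot> (\<alpha> x f \<cdot> u)"
        using \<alpha>(5)[OF xfu j] j by (simp add: comp_assoc)
    qed (use \<alpha>[OF xf] \<alpha>[OF xfu] in simp_all)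
  next
    fix x assume x [simp]: "x \<in> Arr E" "Cod E x = Dom E c"
    have a: "actable E Y c x (s0 Y \<cdot> (c \<cdot> x))" by (simp add: actable_def)
    show "\<alpha> x (s0 Y \<cdot> (c \<cdot> x)) = x"
    proof (rule L_eqI)
      fix j assume j: "j \<in> Obj J"
      then show "l j \<cdot> \<alpha> x (s0 Y \<cdot> (c \<cdot> x)) = l j \<cdot> x"
        using \<alpha>(5)[OF a] act_unit[of "F0 j" "l j \<cdot> x"] by (simp add: bl_elt)
    qed (use \<alpha>[OF a] in simp_all)
  next
    fix x g f assume xg: "actable E Y c x g" and fg: "composable E Y f g"
    have a: "actable E Y c x (icomp E Y f g)" and a': "actable E Y c (\<alpha> x g) f"
      using xg fg \<alpha>[OF xg] icomp_arr[OF fg] by (auto simp: actable_def composable_iff)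
    show "\<alpha> (\<alpha> x g) f = \<alpha> x (icomp E Y f g)"
    proof (rule L_eqI)
      show "l j \<cdot> \<alpha> (\<alpha> x g) f = l j \<cdot> \<alpha> x (icomp E Y f g)" if j: "j \<in> Obj J" for j
        using \<alpha>(5)[OF a j] \<alpha>(5)[OF a' j] \<alpha>(5)[OF xg j] act_icomp[OF _ actable_l[OF j xg] fg] j
        by simp
    qed (use \<alpha>[OF xg] \<alpha>[OF a] \<alpha>[OF a'] icomp_arr[OF fg] in simp_all)
  qed simp_all
  \<comment> \<open>The action of \<open>Z\<close> is only known to agree with \<alpha> on actable
    pairs, and equivariance speaks of no others.\<close>
  from realize[OF this] obtain Z where Z [simp]: "Z \<in> Obj D" "b Z = c"
    and act_Z: "\<And>x f. actable E Y c x f \<Longrightarrow> act Z x f = \<alpha> x f"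
    by blast
  have U0_Z [simp]: "U0 Z = L" using Dom_b[of Z] by simp
  have "\<forall>j\<in>Obj J. \<exists>k \<in> hom D Z (F0 j). U1 k = l j"
    by (intro ballI full) (simp_all add: hom_iff bl act_Z \<alpha>)
  then obtain t where t: "\<And>j. j \<in> Obj J \<Longrightarrow> t j \<in> hom D Z (F0 j) \<and> U1 (t j) = l j"
    by metis
  then have t_arr [simp]: "t j \<in> Arr D" "Dom D (t j) = Z" "Cod D (t j) = F0 j" "U1 (t j) = l j"
    if "j \<in> Obj J" for j
    using that by (auto simp: hom_iff)
  have "is_limit J D F0 F1 Z t"
    unfolding is_limit_def
  proof (intro conjI allI impI)
    have "F1 e \<cdot>\<^bsub>D\<^esub> t (Dom J e) = t (Cod J e)" if "e \<in> Arr J" for e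
      by (rule faithful[of _ Z "F0 (Cod J e)"]) (use that in \<open>simp_all add: hom_iff l_nat\<close>)
    then show "is_cone J D F0 F1 Z t" by (simp add: is_cone_def t)
  next
    fix M m assume m: "is_cone J D F0 F1 M m"
    then have M [simp]: "M \<in> Obj D" by (simp add: is_cone_def)
    have m_arr [simp]: "m j \<in> Arr D" "Dom D (m j) = M" "Cod D (m j) = F0 j" if "j \<in> Obj J" for j
      using m that by (auto simp: is_cone_def hom_iff)
    have m_nat: "F1 e \<cdot>\<^bsub>D\<^esub> m (Dom J e) = m (Cod J e)" if "e \<in> Arr J" for e
      using m that by (auto simp: is_cone_def)
    have "U1 (F1 e) \<cdot> U1 (m (Dom J e)) = U1 (m (Cod J e))" if "e \<in> Arr J" for e
      using that by (simp flip: m_nat)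
    then have "is_cone J E ?G0 ?G1 (U0 M) (\<lambda>j. U1 (m j))"
      by (simp add: is_cone_def hom_iff)
    moreover have bm: "b (F0 j) \<cdot> U1 (m j) = b M" if "j \<in> Obj J" for j
      using b_nat[of "m j"] that by simp
    ultimately have "\<exists>!u. u \<in> hom E (U0 M) L \<and> c \<cdot> u = b M \<and> (\<forall>j\<in>Obj J. l j \<cdot> u = U1 (m j))"
      by (intro univ) (simp_all add: hom_iff)
    then obtain u where "u \<in> hom E (U0 M) L" and cu: "c \<cdot> u = b M"
      and lu: "\<And>j. j \<in> Obj J \<Longrightarrow> l j \<cdot> u = U1 (m j)"
      by blast
    then have u [simp]: "u \<in> Arr E" "Dom E u = U0 M" "Cod E u = L" by (auto simp: hom_iff)
    have cu_elt: "c \<cdot> (u \<cdot> x) = b M \<cdot> x" and lu_elt: "\<And>j. j \<in> Obj J \<Longrightarrow> l j \<cdot> (u \<cdot> x) = U1 (m j) \<cdot> x"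
      if "x \<in> Arr E" "Cod E x = U0 M" for x
      using that comp_eq_extend1[OF cu, of x] comp_eq_extend1[OF lu, of _ x] by simp_all
    have "\<exists>k \<in> hom D M Z. U1 k = u"
    proof (rule full)
      fix x f assume xf: "actable E Y (b M) x f"
      then have xf' [simp]: "x \<in> Arr E" "Cod E x = U0 M" by (auto simp: actable_def)
      have uxf: "actable E Y c (u \<cdot> x) f" using xf by (auto simp: actable_def cu_elt)
      note A = act_arr[OF M xf]
      \<comment> \<open>Both sides have the same composite with each leg, because \<open>m j\<close>
        is equivariant and \<alpha> is computed on the legs.\<close>
      have "u \<cdot> act M x f = \<alpha> (u \<cdot> x) f"
      proof (rule L_eqI)
        show "c \<cdot> (u \<cdot> act M x f) = c \<cdot> \<alpha> (u \<cdot> x) f"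
          using A b_act[OF M xf] \<alpha>(4)[OF uxf] by (simp add: cu_elt)
        show "l j \<cdot> (u \<cdot> act M x f) = l j \<cdot> \<alpha> (u \<cdot> x) f" if j: "j \<in> Obj J" for j
          using A \<alpha>(5)[OF uxf j] equivariant[of "m j" x f] xf j by (simp add: lu_elt)
      qed (use A \<alpha>[OF uxf] in simp_all)
      then show "u \<cdot> act M x f = act Z (u \<cdot> x) f" by (simp add: act_Z[OF uxf])
    qed (simp_all add: hom_iff cu)
    then obtain k where k [simp]: "k \<in> Arr D" "Dom D k = M" "Cod D k = Z" "U1 k = u"
      by (auto simp: hom_iff)
    show "\<exists>!k. k \<in> hom D M Z \<and> (\<forall>j\<in>Obj J. t j \<cdot>\<^bsub>D\<^esub> k = m j)"
    proof (rule ex1I[of _ k])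
      have "t j \<cdot>\<^bsub>D\<^esub> k = m j" if "j \<in> Obj J" for j
        by (rule faithful[of _ M "F0 j"]) (use that in \<open>simp_all add: hom_iff lu\<close>)
      then show "k \<in> hom D M Z \<and> (\<forall>j\<in>Obj J. t j \<cdot>\<^bsub>D\<^esub> k = m j)" by (simp add: hom_iff)
    next
      fix k' assume k': "k' \<in> hom D M Z \<and> (\<forall>j\<in>Obj J. t j \<cdot>\<^bsub>D\<^esub> k' = m j)"
      then have k'_arr [simp]: "k' \<in> Arr D" "Dom D k' = M" "Cod D k' = Z" by (auto simp: hom_iff)
      have "U1 k' = u"
      proof (rule L_eqI)
        show "c \<cdot> U1 k' = c \<cdot> u" using b_nat[of k'] cu by simp
        show "l j \<cdot> U1 k' = l j \<cdot> u" if j: "j \<in> Obj J" for j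
        proof -
          have "U1 (t j \<cdot>\<^bsub>D\<^esub> k') = U1 (m j)" using k' j by simp
          then show ?thesis using j by (simp add: lu)
        qed
      qed simp_all
      then show "k' = k" by (intro faithful[of _ M Z]) (simp_all add: hom_iff)
    qed
  qed
  then show "\<exists>L l. is_limit J D F0 F1 L l" by blast
qed


text \<open>The free action on \<open>a\<close>: its elements are pairs of an arrow \<open>g\<close> of \<open>Y\<close> and an element \<open>x\<close> over
  the codomain of \<open>g\<close>, and \<open>f\<close> acts by composition with \<open>g\<close>.\<close>

lemma free_exists:
  assumes [simp]: "a \<in> Arr E" "Cod E a = ob0 Y"
  shows "\<exists>F \<eta>. F \<in> Obj D \<and> \<eta> \<in> hom E (Dom E a) (U0 F) \<and> b F \<cdot> \<eta> = a \<and>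
    (\<forall>A\<in>Obj D. \<forall>x\<in>hom E (Dom E a) (U0 A). b A \<cdot> x = a \<longrightarrow>
      (\<exists>!k. k \<in> hom D F A \<and> U1 k \<cdot> \<eta> = x))"
proof -
  obtain p q where P: "is_pullback E (d1 Y) a p q"
    by (rule pullback_exists[OF category_axioms fin_complete, of "d1 Y" a]) simp_all
  note pq [simp] = pullback_arr(3,4,6-8)[OF P]
  have P_eqI: "u = v" if "u \<in> Arr E" "Cod E u = Dom E p" "v \<in> Arr E" "Cod E v = Dom E p"
    "Dom E u = Dom E v" "p \<cdot> u = p \<cdot> v" "q \<cdot> u = q \<cdot> v" for u v
    using pullback_eqI[OF P] that by blast
  have P_eq: "d1 Y \<cdot> (p \<cdot> u) = a \<cdot> (q \<cdot> u)" if "u \<in> Arr E" "Cod E u = Dom E p" for u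
    by (rule comp_eq_extend) (simp_all add: pullback_arr[OF P] that)
  \<comment> \<open>An element \<open>(g, x)\<close> of the free action lies over the domain of
    \<open>g\<close>.\<close>
  define a' where "a' = d0 Y \<cdot> p"
  have a' [simp]: "a' \<in> Arr E" "Dom E a' = Dom E p" "Cod E a' = ob0 Y"
    by (simp_all add: a'_def)
  have a'_elt: "a' \<cdot> u = d0 Y \<cdot> (p \<cdot> u)" if "u \<in> Arr E" "Cod E u = Dom E p" for u
    using that by (simp add: a'_def comp_assoc)
  define \<alpha> where "\<alpha> z f = lift E p q (icomp E Y f (p \<cdot> z)) (q \<cdot> z)" for z f
  have comp_p: "composable E Y f (p \<cdot> z)" if "actable E Y a' z f" for z f
    using that by (auto simp: actable_def composable_iff a'_elt)
  have \<alpha>: "\<alpha> z f \<in> Arr E" "Dom E (\<alpha> z f) = Dom E z" "Cod E (\<alpha> z f) = Dom E p"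
    "p \<cdot> \<alpha> z f = icomp E Y f (p \<cdot> z)" "q \<cdot> \<alpha> z f = q \<cdot> z"
    if zf: "actable E Y a' z f" for z f
  proof -
    have [simp]: "z \<in> Arr E" "f \<in> Arr E" "Dom E f = Dom E z" "Cod E z = Dom E p" "Cod E f = ob1 Y"
      using zf by (auto simp: actable_def)
    note ic = icomp_arr[OF comp_p[OF zf]]
    have "d1 Y \<cdot> icomp E Y f (p \<cdot> z) = a \<cdot> (q \<cdot> z)" by (simp add: ic P_eq)
    note l = lift_works[OF P _ _ _ _ _ this]
    show "\<alpha> z f \<in> Arr E" "Dom E (\<alpha> z f) = Dom E z" "Cod E (\<alpha> z f) = Dom E p"
      "p \<cdot> \<alpha> z f = icomp E Y f (p \<cdot> z)" "q \<cdot> \<alpha> z f = q \<cdot> z"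
      using l by (simp_all add: \<alpha>_def ic)
  qed
  have "right_action E Y a' \<alpha>"
  proof unfold_locales
    fix z f assume zf: "actable E Y a' z f"
    then have zf' [simp]: "z \<in> Arr E" "f \<in> Arr E" "Dom E f = Dom E z" "Cod E z = Dom E p"
      "Cod E f = ob1 Y" and eq: "d1 Y \<cdot> f = a' \<cdot> z"
      by (auto simp: actable_def)
    note \<alpha>' [simp] = \<alpha>[OF zf] and ic = icomp_arr[OF comp_p[OF zf]]
    show "\<alpha> z f \<in> hom E (Dom E z) (Dom E a')" by (simp add: hom_iff)
    show "a' \<cdot> \<alpha> z f = d0 Y \<cdot> f" by (simp add: a'_elt ic)
    fix u assume u [simp]: "u \<in> Arr E" "Cod E u = Dom E z"
    have "d1 Y \<cdot> (f \<cdot> u) = a' \<cdot> (z \<cdot> u)" by (rule comp_eq_extend[OF eq]) simp_all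
    then have zfu: "actable E Y a' (z \<cdot> u) (f \<cdot> u)" by (simp add: actable_def)
    note \<alpha>u = \<alpha>[OF zfu]
    show "\<alpha> (z \<cdot> u) (f \<cdot> u) = \<alpha> z f \<cdot> u"
    proof (rule P_eqI)
      show "p \<cdot> \<alpha> (z \<cdot> u) (f \<cdot> u) = p \<cdot> (\<alpha> z f \<cdot> u)"
        using comp_eq_extend1[OF \<alpha>'(4), of u] icomp_comp[OF comp_p[OF zf], of u]
        by (simp add: \<alpha>u comp_assoc)
      show "q \<cdot> \<alpha> (z \<cdot> u) (f \<cdot> u) = q \<cdot> (\<alpha> z f \<cdot> u)"
        using comp_eq_extend[OF \<alpha>'(5), of u] by (simp add: \<alpha>u)
    qed (simp_all add: \<alpha>u)
  next
    fix z assume z [simp]: "z \<in> Arr E" "Cod E z = Dom E a'"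
    have "actable E Y a' z (s0 Y \<cdot> (a' \<cdot> z))" by (simp add: actable_def)
    note \<alpha>z = \<alpha>[OF this]
    show "\<alpha> z (s0 Y \<cdot> (a' \<cdot> z)) = z"
      by (rule P_eqI) (simp_all add: \<alpha>z, simp add: a'_elt icomp_unit)
  next
    fix z g f assume zg: "actable E Y a' z g" and fg: "composable E Y f g"
    then have [simp]: "z \<in> Arr E" "g \<in> Arr E" "Dom E g = Dom E z" "Cod E z = Dom E p"
      "Cod E g = ob1 Y" "f \<in> Arr E" "Dom E f = Dom E z" "Cod E f = ob1 Y"
      and eq: "d1 Y \<cdot> g = a' \<cdot> z" "d1 Y \<cdot> f = d0 Y \<cdot> g"
      by (auto simp: actable_def composable_iff)
    note ic = icomp_arr[OF fg] and icg = icomp_arr[OF comp_p[OF zg]]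
    have 1: "actable E Y a' (\<alpha> z g) f" and 2: "actable E Y a' z (icomp E Y f g)"
      by (simp_all add: actable_def \<alpha>[OF zg] ic eq icg a'_elt)
    show "\<alpha> (\<alpha> z g) f = \<alpha> z (icomp E Y f g)"
      by (rule P_eqI) (simp_all add: \<alpha>[OF 1] \<alpha>[OF 2] \<alpha>[OF zg] icomp_assoc[OF fg comp_p[OF zg]])
  qed simp_all
  from realize[OF this] obtain F where F [simp]: "F \<in> Obj D" "b F = a'"
    and act_F: "\<And>x f. actable E Y a' x f \<Longrightarrow> act F x f = \<alpha> x f"
    by blast
  have U0_F [simp]: "U0 F = Dom E p" using Dom_b[of F] by simp
  \<comment> \<open>The unit of the adjunction sends \<open>x\<close> to the pair of the identity at
    its image and \<open>x\<close>.\<close>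
  define \<eta> where "\<eta> = lift E p q (s0 Y \<cdot> a) (Id E (Dom E a))"
  have \<eta> [simp]: "\<eta> \<in> Arr E" "Dom E \<eta> = Dom E a" "Cod E \<eta> = Dom E p"
    "p \<cdot> \<eta> = s0 Y \<cdot> a" "q \<cdot> \<eta> = Id E (Dom E a)"
    using lift_works[OF P, of "s0 Y \<cdot> a" "Id E (Dom E a)"] by (simp_all add: \<eta>_def)
  have \<eta>q: "actable E Y a' (\<eta> \<cdot> q) p"
  proof -
    have "p \<cdot> (\<eta> \<cdot> q) = s0 Y \<cdot> (a \<cdot> q)" by (rule comp_eq_extend) simp_all
    then show ?thesis by (simp add: actable_def a'_elt pullback_arr(9)[OF P])
  qed
  \<comment> \<open>Every element \<open>(g, x)\<close> arises from the unit at \<open>x\<close> by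
    acting with \<open>g\<close>; this is that fact for the generic element, the identity. Hence an
    equivariant map is determined by its composite with \<eta>.\<close>
  have generated: "act F (\<eta> \<cdot> q) p = Id E (Dom E p)"
  proof -
    have "p \<cdot> (\<eta> \<cdot> q) = s0 Y \<cdot> (a \<cdot> q)" by (rule comp_eq_extend) simp_all
    then have "p \<cdot> (\<eta> \<cdot> q) = s0 Y \<cdot> (d1 Y \<cdot> p)" by (simp add: pullback_arr(9)[OF P])
    moreover have "q \<cdot> (\<eta> \<cdot> q) = q" by (simp add: comp_eq_extend1[OF \<eta>(5)])
    ultimately have "\<alpha> (\<eta> \<cdot> q) p = Id E (Dom E p)"
      by - (rule P_eqI, simp_all add: \<alpha>[OF \<eta>q] icomp_unit)
    then show ?thesis by (simp add: act_F[OF \<eta>q])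
  qed
  have "\<exists>!k. k \<in> hom D F A \<and> U1 k \<cdot> \<eta> = x"
    if A [simp]: "A \<in> Obj D" and x: "x \<in> hom E (Dom E a) (U0 A)" and bx: "b A \<cdot> x = a" for A x
  proof -
    have x_arr [simp]: "x \<in> Arr E" "Dom E x = Dom E a" "Cod E x = U0 A" using x by (auto simp: hom_iff)
    have bx_elt: "b A \<cdot> (x \<cdot> u) = a \<cdot> u" if "u \<in> Arr E" "Cod E u = Dom E a" for u
      by (rule comp_eq_extend1[OF bx]) (use that in simp_all)
    have xq: "actable E Y (b A) (x \<cdot> q) p"
      by (simp add: actable_def bx_elt pullback_arr(9)[OF P])
    \<comment> \<open>The only possible extension of \<open>x\<close>: the pair
      \<open>(g, t)\<close> must go to the value of \<open>x\<close> at \<open>t\<close>, acted on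
      by \<open>g\<close>.\<close>
    define u where "u = act A (x \<cdot> q) p"
    have u [simp]: "u \<in> Arr E" "Dom E u = Dom E p" "Cod E u = U0 A"
      using act_arr[OF A xq] by (simp_all add: u_def)
    have bu: "b A \<cdot> u = a'"
      using b_act[OF A xq] by (simp add: u_def a'_def)
    have u_elt: "u \<cdot> z = act A (x \<cdot> (q \<cdot> z)) (p \<cdot> z)" if "z \<in> Arr E" "Cod E z = Dom E p" for z
      using that act_comp[OF A xq, of z] by (simp add: u_def comp_assoc)
    have "\<exists>k \<in> hom D F A. U1 k = u"
    proof (rule full)
      fix z f assume "actable E Y (b F) z f"
      then have zf: "actable E Y a' z f" by simp
      then have [simp]: "z \<in> Arr E" "f \<in> Arr E" "Cod E z = Dom E p" by (auto simp: actable_def)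
      have xqz: "actable E Y (b A) (x \<cdot> (q \<cdot> z)) (p \<cdot> z)"
        by (simp add: actable_def bx_elt P_eq)
      have "u \<cdot> act F z f = act A (x \<cdot> (q \<cdot> z)) (icomp E Y f (p \<cdot> z))"
        by (simp add: u_elt act_F[OF zf] \<alpha>[OF zf])
      also have "\<dots> = act A (u \<cdot> z) f"
        using act_icomp[OF A xqz comp_p[OF zf]] by (simp add: u_elt)
      finally show "u \<cdot> act F z f = act A (u \<cdot> z) f" .
    qed (simp_all add: hom_iff bu)
    then obtain k where k [simp]: "k \<in> Arr D" "Dom D k = F" "Cod D k = A" "U1 k = u"
      by (auto simp: hom_iff)
    have "u \<cdot> \<eta> = x"
      using act_unit[OF A, of x] bx by (simp add: u_elt)
    moreover have "l = k" if l: "l \<in> hom D F A" "U1 l \<cdot> \<eta> = x" for l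
    proof -
      have l_arr [simp]: "l \<in> Arr D" "Dom D l = F" "Cod D l = A" using l by (auto simp: hom_iff)
      have "U1 l = U1 l \<cdot> act F (\<eta> \<cdot> q) p" by (simp add: generated)
      also have "\<dots> = act A (U1 l \<cdot> (\<eta> \<cdot> q)) p"
        using equivariant[of l "\<eta> \<cdot> q" p] \<eta>q by simp
      also have "U1 l \<cdot> (\<eta> \<cdot> q) = x \<cdot> q"
        by (rule comp_eq_extend1[OF l(2)]) simp_all
      finally show ?thesis by (intro faithful[OF l(1)]) (simp_all add: hom_iff u_def)
    qed
    ultimately show ?thesis by (intro ex1I[of _ k]) (auto simp: hom_iff)
  qed
  moreover have "b F \<cdot> \<eta> = a" by (simp add: a'_elt)
  ultimately show ?thesis
    by (intro exI[of _ F] exI[of _ \<eta>]) (simp add: hom_iff)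
qed

section \<open>Underlying relations: preservation and reflection\<close>

abbreviation U_rel :: "'b \<times> 'b \<Rightarrow> 'm \<times> 'm" where
  "U_rel R \<equiv> (U1 (fst R), U1 (snd R))"

lemma relation_arr:
  assumes "relation_on D A R"
  shows "fst R \<in> Arr D" "snd R \<in> Arr D" "Dom D (snd R) = Dom D (fst R)"
    "Cod D (fst R) = A" "Cod D (snd R) = A"
  using assms by (auto simp: relation_on_def)

text \<open>Elements \<open>u\<close> and \<open>v\<close> with equal images under
  \<open>fst R\<close> lie over the same \<open>a\<close>, so both are arrows from one free action,
  and joint monicity in \<open>D\<close> applies to these.\<close>

lemma relation_U_rel:
  assumes R: "relation_on D A R"
  shows "relation_on E (U0 A) (U_rel R)"
proof -
  note [simp] = relation_arr[OF R]
  let ?R = "Dom D (fst R)"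
  have A [simp]: "A \<in> Obj D" "?R \<in> Obj D" using D.Cod_in_Obj[of "fst R"] by simp_all
  have "u = v" if uv: "u \<in> hom E V (U0 ?R)" "v \<in> hom E V (U0 ?R)"
    "U1 (fst R) \<cdot> u = U1 (fst R) \<cdot> v" "U1 (snd R) \<cdot> u = U1 (snd R) \<cdot> v" for V u v
  proof -
    have [simp]: "u \<in> Arr E" "Dom E u = V" "Cod E u = U0 ?R" "v \<in> Arr E" "Dom E v = V" "Cod E v = U0 ?R"
      using uv by (auto simp: hom_iff)
    define a where "a = b ?R \<cdot> u"
    have a [simp]: "a \<in> Arr E" "Cod E a = ob0 Y" "Dom E a = V" by (simp_all add: a_def)
    have av: "b ?R \<cdot> v = a"
      using b_nat_elt[of "fst R" u] b_nat_elt[of "fst R" v] uv(3) by (simp add: a_def)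
    obtain F \<eta> where F [simp]: "F \<in> Obj D" and \<eta>: "\<eta> \<in> hom E V (U0 F)"
      and free: "\<And>A x. A \<in> Obj D \<Longrightarrow> x \<in> hom E V (U0 A) \<Longrightarrow> b A \<cdot> x = a \<Longrightarrow>
        \<exists>!k. k \<in> hom D F A \<and> U1 k \<cdot> \<eta> = x"
      using free_exists[of a] by auto
    have [simp]: "\<eta> \<in> Arr E" "Dom E \<eta> = V" "Cod E \<eta> = U0 F" using \<eta> by (auto simp: hom_iff)
    obtain k where k: "k \<in> hom D F ?R" "U1 k \<cdot> \<eta> = u"
      using free[OF A(2) uv(1)] a_def by blast
    obtain l where l: "l \<in> hom D F ?R" "U1 l \<cdot> \<eta> = v"
      using free[OF A(2) uv(2) av] by blast
    have [simp]: "k \<in> Arr D" "Dom D k = F" "Cod D k = ?R" "l \<in> Arr D" "Dom D l = F" "Cod D l = ?R"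
      using k l by (auto simp: hom_iff)
    have eq: "e \<cdot>\<^bsub>D\<^esub> k = e \<cdot>\<^bsub>D\<^esub> l"
      if e [simp]: "e \<in> Arr D" "Dom D e = ?R" "Cod D e = A" and "U1 e \<cdot> u = U1 e \<cdot> v" for e
    proof -
      have "b A \<cdot> (U1 e \<cdot> u) = a" using b_nat_elt[of e u] by (simp add: a_def)
      then have "\<exists>!m. m \<in> hom D F A \<and> U1 m \<cdot> \<eta> = U1 e \<cdot> u"
        by (intro free) (simp_all add: hom_iff)
      moreover have "e \<cdot>\<^bsub>D\<^esub> k \<in> hom D F A \<and> U1 (e \<cdot>\<^bsub>D\<^esub> k) \<cdot> \<eta> = U1 e \<cdot> u"
        "e \<cdot>\<^bsub>D\<^esub> l \<in> hom D F A \<and> U1 (e \<cdot>\<^bsub>D\<^esub> l) \<cdot> \<eta> = U1 e \<cdot> u"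
        using k l that(4) by (simp_all add: hom_iff comp_assoc)
      ultimately show ?thesis by blast
    qed
    have "k = l"
      using R k(1) l(1) eq[of "fst R"] eq[of "snd R"] uv(3,4) unfolding relation_on_def by simp
    then show "u = v" using k l by simp
  qed
  then show ?thesis by (simp add: relation_on_def)
qed

text \<open>Both projections of \<open>R\<close> are maps over \<open>ob0 Y\<close>, so
  \<open>U_rel R\<close> relates only elements of one fibre. This is what lets fibrewise arguments
  settle questions about all elements of \<open>E\<close>.\<close>

lemma related_over:
  assumes R: "relation_on D A R" and r: "related E (U_rel R) x y"
  shows "b A \<cdot> x = b A \<cdot> y"
proof -
  note [simp] = relation_arr[OF R]
  obtain h where "h \<in> Arr E" "Cod E h = U0 (Dom D (fst R))" "U1 (fst R) \<cdot> h = x" "U1 (snd R) \<cdot> h = y"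
    using r by (auto simp: related_def)
  then show ?thesis using b_nat_elt[of "fst R" h] b_nat_elt[of "snd R" h] by simp
qed

text \<open>Elements of \<open>U0 A\<close> over \<open>a\<close> are arrows into \<open>A\<close> from the free action on \<open>a\<close>. Hence \<open>U_rel\<close>
  inherits every property of a relation that is expressed by generalized elements.\<close>

abbreviation fibre :: "'a \<Rightarrow> 'm \<Rightarrow> 'm set" where
  "fibre A a \<equiv> {x \<in> hom E (Dom E a) (U0 A). b A \<cdot> x = a}"

text \<open>The same \<open>F\<close> and \<open>hat\<close> serve all relations on \<open>A\<close>
  at once, as the comparison of an intersection with its two factors requires.\<close>

lemma fibre_represented:
  assumes [simp]: "a \<in> Arr E" "Cod E a = ob0 Y" and A [simp]: "A \<in> Obj D"
  shows "\<exists>F \<in> Obj D. \<exists>hat. (\<forall>x \<in> fibre A a. hat x \<in> hom D F A) \<and> (\<forall>R. relation_on D A R \<longrightarrow>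
    (\<forall>x \<in> fibre A a. \<forall>y \<in> fibre A a. related E (U_rel R) x y \<longleftrightarrow> related D R (hat x) (hat y)))"
proof -
  obtain F \<eta> where F [simp]: "F \<in> Obj D" and \<eta>: "\<eta> \<in> hom E (Dom E a) (U0 F)"
    and free: "\<And>A x. A \<in> Obj D \<Longrightarrow> x \<in> hom E (Dom E a) (U0 A) \<Longrightarrow> b A \<cdot> x = a \<Longrightarrow>
      \<exists>!k. k \<in> hom D F A \<and> U1 k \<cdot> \<eta> = x"
    using free_exists[of a] by auto
  have [simp]: "\<eta> \<in> Arr E" "Dom E \<eta> = Dom E a" "Cod E \<eta> = U0 F" using \<eta> by (auto simp: hom_iff)
  define hat where "hat A x = (THE k. k \<in> hom D F A \<and> U1 k \<cdot> \<eta> = x)" for A x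
  have hat: "hat A x \<in> hom D F A" "U1 (hat A x) \<cdot> \<eta> = x"
    if "A \<in> Obj D" "x \<in> hom E (Dom E a) (U0 A)" "b A \<cdot> x = a" for A x
    using theI'[OF free[OF that]] by (auto simp: hat_def)
  have hat_eq: "k = hat A x" if "A \<in> Obj D" "x \<in> hom E (Dom E a) (U0 A)" "b A \<cdot> x = a"
    "k \<in> hom D F A" "U1 k \<cdot> \<eta> = x" for A x k
    using free[OF that(1-3)] hat[OF that(1-3)] that(4,5) by blast
  have "related E (U_rel R) x y \<longleftrightarrow> related D R (hat A x) (hat A y)"
    if R: "relation_on D A R" and x: "x \<in> hom E (Dom E a) (U0 A)" "b A \<cdot> x = a"
      and y: "y \<in> hom E (Dom E a) (U0 A)" "b A \<cdot> y = a" for R x y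
  proof
    note [simp] = relation_arr[OF R]
    note hx = hat[OF A x] and hy = hat[OF A y]
    {
      assume "related E (U_rel R) x y"
      then obtain h where h [simp]: "h \<in> Arr E" "Cod E h = U0 (Dom D (fst R))"
        and hxy: "U1 (fst R) \<cdot> h = x" "U1 (snd R) \<cdot> h = y"
        by (auto simp: related_def)
      have [simp]: "Dom E h = Dom E a" using hxy(1) x by (auto simp: hom_iff)
      have bh: "b (Dom D (fst R)) \<cdot> h = a" using b_nat_elt[of "fst R" h] x(2) by (simp add: hxy(1))
      \<comment> \<open>The witness \<open>h\<close> lies over the same \<open>a\<close> as
        \<open>x\<close> and \<open>y\<close>, so it too is represented by an arrow from
        \<open>F\<close>; for this, \<open>hat\<close> is defined at all objects and not only at
        \<open>A\<close>.\<close>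
      define k where "k = hat (Dom D (fst R)) h"
      have "k \<in> hom D F (Dom D (fst R))" and k: "U1 k \<cdot> \<eta> = h"
        using hat[of "Dom D (fst R)" h] bh by (simp_all add: k_def hom_iff)
      then have [simp]: "k \<in> Arr D" "Dom D k = F" "Cod D k = Dom D (fst R)" by (auto simp: hom_iff)
      have "fst R \<cdot>\<^bsub>D\<^esub> k = hat A x" "snd R \<cdot>\<^bsub>D\<^esub> k = hat A y"
        using hxy by (intro hat_eq A x y; simp add: hom_iff comp_assoc k)+
      then show "related D R (hat A x) (hat A y)"
        unfolding related_def by (intro bexI[of _ k]) simp_all
    next
      assume "related D R (hat A x) (hat A y)"
      then obtain h where h [simp]: "h \<in> Arr D" "Cod D h = Dom D (fst R)"
        and hxy: "fst R \<cdot>\<^bsub>D\<^esub> h = hat A x" "snd R \<cdot>\<^bsub>D\<^esub> h = hat A y"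
        by (auto simp: related_def)
      have "Dom D (fst R \<cdot>\<^bsub>D\<^esub> h) = F" using hxy(1) hx(1) by (simp add: hom_iff)
      then have [simp]: "Dom D h = F" by simp
      have "U1 (fst R) \<cdot> (U1 h \<cdot> \<eta>) = U1 (fst R \<cdot>\<^bsub>D\<^esub> h) \<cdot> \<eta>"
        "U1 (snd R) \<cdot> (U1 h \<cdot> \<eta>) = U1 (snd R \<cdot>\<^bsub>D\<^esub> h) \<cdot> \<eta>"
        by (simp_all add: comp_assoc)
      then have "U1 (fst R) \<cdot> (U1 h \<cdot> \<eta>) = x" "U1 (snd R) \<cdot> (U1 h \<cdot> \<eta>) = y"
        by (simp_all only: hxy hx hy)
      then show "related E (U_rel R) x y"
        unfolding related_def by (intro bexI[of _ "U1 h \<cdot> \<eta>"]) simp_all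
    }
  qed
  then show ?thesis using hat(1)[OF A] by (intro bexI[OF _ F] exI[of _ "hat A"]) simp
qed

text \<open>Each element \<open>x\<close> is tested in the fibre over \<open>b A \<cdot> x\<close>,
  whose elements are arrows from one object of \<open>D\<close>. Elements related to
  \<open>x\<close>, directly or through a chain, stay in this fibre by
  \<open>related_over\<close>.\<close>

lemma equivalence_U_rel:
  assumes A: "A \<in> Obj D" and R: "equivalence_relation_on D A R"
  shows "equivalence_relation_on E (U0 A) (U_rel R)"
proof -
  have rel: "relation_on D A R" using R by (simp add: equivalence_relation_on_def)
  have eqv: "equiv (hom D V A) {(x, y). x \<in> hom D V A \<and> y \<in> hom D V A \<and> related D R x y}"
    if "V \<in> Obj D" for V
    using R that by (simp add: equivalence_relation_on_def)
  have D_refl: "related D R x x" if "V \<in> Obj D" "x \<in> hom D V A" for V x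
    using eqv[OF that(1)] that(2) by (auto simp: equiv_def refl_on_def)
  have D_sym: "related D R y x"
    if "V \<in> Obj D" "x \<in> hom D V A" "y \<in> hom D V A" "related D R x y" for V x y
    using eqv[OF that(1)] that unfolding equiv_def sym_def by blast
  have D_trans: "related D R x z"
    if "V \<in> Obj D" "x \<in> hom D V A" "y \<in> hom D V A" "z \<in> hom D V A" "related D R x y" "related D R y z"
    for V x y z
    using eqv[OF that(1)] that unfolding equiv_def trans_def by blast
  let ?r = "related E (U_rel R)"
  have hat: "\<exists>F \<in> Obj D. \<exists>hat. (\<forall>y \<in> fibre A (b A \<cdot> x). hat y \<in> hom D F A) \<and>
      (\<forall>y \<in> fibre A (b A \<cdot> x). \<forall>z \<in> fibre A (b A \<cdot> x). ?r y z \<longleftrightarrow> related D R (hat y) (hat z))"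
    if "x \<in> hom E V (U0 A)" for V x
  proof -
    have "b A \<cdot> x \<in> Arr E" "Cod E (b A \<cdot> x) = ob0 Y" using that A by (auto simp: hom_iff)
    from fibre_represented[OF this A] rel show ?thesis by blast
  qed
  have fib: "y \<in> fibre A (b A \<cdot> x)"
    if "x \<in> hom E V (U0 A)" "y \<in> hom E V (U0 A)" "b A \<cdot> y = b A \<cdot> x" for V x y
    using that A by (auto simp: hom_iff)
  note over = related_over[OF rel]
  have refl: "?r x x" if x: "x \<in> hom E V (U0 A)" for V x
    using hat[OF x] fib[OF x x] D_refl by blast
  have sym: "?r y x" if x: "x \<in> hom E V (U0 A)" and y: "y \<in> hom E V (U0 A)" and xy: "?r x y" for V x y
    using hat[OF x] fib[OF x x] fib[OF x y over[OF xy, symmetric]] D_sym xy by blast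
  have trans: "?r x z" if x: "x \<in> hom E V (U0 A)" and y: "y \<in> hom E V (U0 A)" and z: "z \<in> hom E V (U0 A)"
    and xy: "?r x y" and yz: "?r y z" for V x y z
  proof -
    obtain F h where F: "F \<in> Obj D" and h: "\<forall>y \<in> fibre A (b A \<cdot> x). h y \<in> hom D F A"
      and r: "\<forall>y \<in> fibre A (b A \<cdot> x). \<forall>z \<in> fibre A (b A \<cdot> x). ?r y z \<longleftrightarrow> related D R (h y) (h z)"
      using hat[OF x] by blast
    have X: "x \<in> fibre A (b A \<cdot> x)" and Y: "y \<in> fibre A (b A \<cdot> x)" and Z: "z \<in> fibre A (b A \<cdot> x)"
      using fib[OF x x] fib[OF x y] fib[OF x z] over[OF xy] over[OF yz] by simp_all
    have "related D R (h x) (h z)"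
      using D_trans[OF F] h r X Y Z xy yz by blast
    then show ?thesis using r X Z by blast
  qed
  show ?thesis
    unfolding equivalence_relation_on_def
    by (intro conjI ballI equivI relation_U_rel[OF rel] refl_onI symI transI)
      (auto intro: refl sym trans)
qed

text \<open>Within a fibre the equivalence is the one in \<open>D\<close>, read through representing
  arrows; between different fibres neither side can hold.\<close>

lemma intersection_U_rel:
  assumes A: "A \<in> Obj D" and R: "relation_on D A R" and S: "relation_on D A S"
    and W: "is_intersection D A R S W"
  shows "is_intersection E (U0 A) (U_rel R) (U_rel S) (U_rel W)"
proof -
  have relW: "relation_on D A W" using W by (simp add: is_intersection_def)
  have D_iff: "related D W x y \<longleftrightarrow> related D R x y \<and> related D S x y"
    if "x \<in> hom D V A" "y \<in> hom D V A" for V x y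
    using W that by (auto simp: is_intersection_def)
  have "related E (U_rel W) x y \<longleftrightarrow> related E (U_rel R) x y \<and> related E (U_rel S) x y"
    if x: "x \<in> hom E V (U0 A)" and y: "y \<in> hom E V (U0 A)" for V x y
  proof (cases "b A \<cdot> x = b A \<cdot> y")
    case True
    have a: "b A \<cdot> x \<in> Arr E" "Cod E (b A \<cdot> x) = ob0 Y" "Dom E (b A \<cdot> x) = V"
      using x A by (auto simp: hom_iff)
    obtain F h where h: "\<forall>x \<in> fibre A (b A \<cdot> x). h x \<in> hom D F A"
      and iff: "\<forall>R. relation_on D A R \<longrightarrow> (\<forall>y \<in> fibre A (b A \<cdot> x). \<forall>z \<in> fibre A (b A \<cdot> x).
        related E (U_rel R) y z \<longleftrightarrow> related D R (h y) (h z))"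
      using fibre_represented[OF a(1,2) A] by blast
    have "x \<in> fibre A (b A \<cdot> x)" "y \<in> fibre A (b A \<cdot> x)" using x y a True by simp_all
    then show ?thesis using iff relW R S h D_iff[of "h x" F "h y"] by simp
  next
    case False
    then show ?thesis using related_over[OF relW] related_over[OF R] by blast
  qed
  then show ?thesis using relation_U_rel[OF relW] by (simp add: is_intersection_def)
qed

text \<open>An arrow of \<open>E\<close> between underlying objects is equivariant as soon as its composites with
  a jointly monic pair of equivariant maps are.\<close>

lemma related_reflect:
  assumes R: "relation_on D A R" and x: "x \<in> hom D V A" and y: "y \<in> hom D V A"
    and r: "related E (U_rel R) (U1 x) (U1 y)"
  shows "related D R x y"
proof -
  note [simp] = relation_arr[OF R]
  let ?R = "Dom D (fst R)"
  have [simp]: "x \<in> Arr D" "Dom D x = V" "Cod D x = A" "y \<in> Arr D" "Dom D y = V" "Cod D y = A"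
    using x y by (auto simp: hom_iff)
  have [simp]: "A \<in> Obj D" "?R \<in> Obj D" "V \<in> Obj D"
    using D.Cod_in_Obj[of "fst R"] D.Dom_in_Obj[of x] by simp_all
  obtain u where u [simp]: "u \<in> Arr E" "Cod E u = U0 ?R"
    and eq: "U1 (fst R) \<cdot> u = U1 x" "U1 (snd R) \<cdot> u = U1 y"
    using r by (auto simp: related_def)
  have "Dom E (U1 (fst R) \<cdot> u) = U0 V" by (simp only: eq) simp
  then have [simp]: "Dom E u = U0 V" by simp
  have bu: "b ?R \<cdot> u = b V" using b_nat_elt[of "fst R" u] eq b_nat[of x] by simp
  have bu_elt: "b ?R \<cdot> (u \<cdot> z) = b V \<cdot> z" if "z \<in> Arr E" "Cod E z = U0 V" for z
    by (rule comp_eq_extend1[OF bu]) (use that in simp_all)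
  have "\<exists>k \<in> hom D V ?R. U1 k = u"
  proof (rule full)
    fix z f assume zf: "actable E Y (b V) z f"
    then have [simp]: "z \<in> Arr E" "Cod E z = U0 V" by (auto simp: actable_def)
    have uzf: "actable E Y (b ?R) (u \<cdot> z) f" using zf by (auto simp: actable_def bu_elt)
    have [simp]: "act V z f \<in> Arr E" "Dom E (act V z f) = Dom E z" "Cod E (act V z f) = U0 V"
      "act ?R (u \<cdot> z) f \<in> Arr E" "Dom E (act ?R (u \<cdot> z) f) = Dom E z"
      "Cod E (act ?R (u \<cdot> z) f) = U0 ?R"
      using act_arr[OF _ zf] act_arr[OF _ uzf] by simp_all
    \<comment> \<open>The composite \<open>U1 r \<cdot> u\<close> is the equivariant
      \<open>U1 w\<close>, and \<open>r\<close> is equivariant itself, so both sides equal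
      \<open>act A (U1 w \<cdot> z) f\<close>.\<close>
    have "U1 r \<cdot> (u \<cdot> act V z f) = U1 r \<cdot> act ?R (u \<cdot> z) f"
      if [simp]: "r \<in> Arr D" "Dom D r = ?R" "Cod D r = A" "w \<in> Arr D" "Dom D w = V" "Cod D w = A"
        and rw: "U1 r \<cdot> u = U1 w" for r w
      using equivariant[of r "u \<cdot> z" f] equivariant[of w z f] zf uzf
        comp_eq_extend1[OF rw, of "act V z f"] comp_eq_extend1[OF rw, of z] by simp
    from this[of "fst R" x] this[of "snd R" y]
    have "U1 (fst R) \<cdot> (u \<cdot> act V z f) = U1 (fst R) \<cdot> act ?R (u \<cdot> z) f"
      "U1 (snd R) \<cdot> (u \<cdot> act V z f) = U1 (snd R) \<cdot> act ?R (u \<cdot> z) f"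
      by (simp_all add: eq)
    then show "u \<cdot> act V z f = act ?R (u \<cdot> z) f"
      using relation_U_rel[OF R] by (simp add: relation_on_def hom_iff)
  qed (simp_all add: hom_iff bu)
  then obtain k where k [simp]: "k \<in> Arr D" "Dom D k = V" "Cod D k = ?R" "U1 k = u"
    by (auto simp: hom_iff)
  have "fst R \<cdot>\<^bsub>D\<^esub> k = x" "snd R \<cdot>\<^bsub>D\<^esub> k = y"
    by (rule faithful[of _ V A]; simp add: hom_iff eq)+
  then show ?thesis unfolding related_def by (intro bexI[of _ k]) simp_all
qed

lemma related_U1:
  assumes R: "relation_on D A R" and r: "related D R x y"
  shows "related E (U_rel R) (U1 x) (U1 y)"
proof -
  note [simp] = relation_arr[OF R]
  obtain h where [simp]: "h \<in> Arr D" "Cod D h = Dom D (fst R)"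
    and "fst R \<cdot>\<^bsub>D\<^esub> h = x" "snd R \<cdot>\<^bsub>D\<^esub> h = y"
    using r by (auto simp: related_def)
  then have "U1 x = U1 (fst R) \<cdot> U1 h" "U1 y = U1 (snd R) \<cdot> U1 h"
    by (simp_all flip: U1_comp)
  then show ?thesis unfolding related_def by (intro bexI[of _ "U1 h"]) simp_all
qed

text \<open>The configuration is moved to \<open>E\<close> by \<open>related_U1\<close> and the
  preservation lemmas; \<open>related_reflect\<close> brings the conclusion back to
  \<open>D\<close>.\<close>

lemma D_shifting_lemma:
  assumes shift: "shifting_lemma E"
  shows "shifting_lemma D"
  unfolding shifting_lemma_def
proof (intro ballI allI impI, elim conjE)
  fix A R S T W V x y x' y'
  assume A: "A \<in> Obj D"
    and R: "equivalence_relation_on D A R" and S: "equivalence_relation_on D A S"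
    and T: "equivalence_relation_on D A T"
    and W: "is_intersection D A R S W" and incl: "relation_incl D W T"
    and xy: "x \<in> hom D V A" "y \<in> hom D V A" "x' \<in> hom D V A" "y' \<in> hom D V A"
    and r: "related D S x y" "related D S x' y'" "related D R x x'" "related D R y y'" "related D T x x'"
  have rel: "relation_on D A R" "relation_on D A S" "relation_on D A T" "relation_on D A W"
    using R S T W by (simp_all add: equivalence_relation_on_def is_intersection_def)
  note arrT [simp] = relation_arr[OF rel(3)] and arrW [simp] = relation_arr[OF rel(4)]
  obtain h where "h \<in> hom D (Dom D (fst W)) (Dom D (fst T))"
    and hW: "fst T \<cdot>\<^bsub>D\<^esub> h = fst W" "snd T \<cdot>\<^bsub>D\<^esub> h = snd W"
    using incl by (auto simp: relation_incl_def)
  then have [simp]: "h \<in> Arr D" "Dom D h = Dom D (fst W)" "Cod D h = Dom D (fst T)"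
    by (auto simp: hom_iff)
  have "relation_incl E (U_rel W) (U_rel T)"
    unfolding relation_incl_def
    by (intro bexI[of _ "U1 h"] conjI) (simp_all add: hom_iff flip: U1_comp, simp_all add: hW)
  moreover have "U1 x \<in> hom E (U0 V) (U0 A)" "U1 y \<in> hom E (U0 V) (U0 A)"
    "U1 x' \<in> hom E (U0 V) (U0 A)" "U1 y' \<in> hom E (U0 V) (U0 A)"
    using xy by (auto simp: hom_iff)
  ultimately have "related E (U_rel T) (U1 y) (U1 y')"
    using shift[unfolded shifting_lemma_def, rule_format, of "U0 A" "U_rel R" "U_rel S" "U_rel T" "U_rel W"
        "U1 x" "U0 V" "U1 y" "U1 x'" "U1 y'"]
      equivalence_U_rel[OF A R] equivalence_U_rel[OF A S] equivalence_U_rel[OF A T]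
      intersection_U_rel[OF A rel(1,2) W] A
      related_U1[OF rel(2) r(1)] related_U1[OF rel(2) r(2)] related_U1[OF rel(1) r(3)]
      related_U1[OF rel(1) r(4)] related_U1[OF rel(3) r(5)]
    by simp
  then show "related D T y y'" by (rule related_reflect[OF rel(3) xy(2,4)])
qed

lemma D_gumm_category: "shifting_lemma E \<Longrightarrow> gumm_category D"
  by (simp add: gumm_category_def D.category_axioms D_finitely_complete D_shifting_lemma)

end

section \<open>Opposite internal categories\<close>

text \<open>The projections are exchanged along with \<open>d0\<close> and \<open>d1\<close>, since
  \<open>pr1\<close> must give the first arrow of a composable pair.\<close>

definition opposite :: "('o, 'm) icat \<Rightarrow> ('o, 'm) icat" where
  "opposite X = \<lparr>ob0 = ob0 X, ob1 = ob1 X, ob2 = ob2 X, d0 = d1 X, d1 = d0 X, s0 = s0 X,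
     pr1 = pr2 X, pr2 = pr1 X, mult = mult X\<rparr>"

lemma opposite_simps [simp]:
  "ob0 (opposite X) = ob0 X" "ob1 (opposite X) = ob1 X" "ob2 (opposite X) = ob2 X"
  "d0 (opposite X) = d1 X" "d1 (opposite X) = d0 X" "s0 (opposite X) = s0 X"
  "pr1 (opposite X) = pr2 X" "pr2 (opposite X) = pr1 X" "mult (opposite X) = mult X"
  by (simp_all add: opposite_def)

lemma opposite_opposite [simp]: "opposite (opposite X) = X"
  by (simp add: opposite_def)

text \<open>The description in \<open>icomp\<close> reads its domain off the first argument, which
  is \<open>f\<close> on one side and \<open>g\<close> on the other; the hypothesis reconciles the
  two.\<close>

lemma icomp_opposite:
  assumes "Dom E f = Dom E g"
  shows "icomp E (opposite X) f g = icomp E X g f"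
proof -
  have "(\<lambda>u. u \<in> hom E (Dom E f) (ob2 X) \<and> pr2 X \<cdot>\<^bsub>E\<^esub> u = f \<and> pr1 X \<cdot>\<^bsub>E\<^esub> u = g) =
    (\<lambda>u. u \<in> hom E (Dom E g) (ob2 X) \<and> pr1 X \<cdot>\<^bsub>E\<^esub> u = g \<and> pr2 X \<cdot>\<^bsub>E\<^esub> u = f)"
    using assms by auto
  then show ?thesis by (simp add: icomp_def)
qed

lemma composable_opposite: "composable E (opposite X) f g \<longleftrightarrow> composable E X g f"
  by (auto simp: composable_iff)

lemma pullback_commute:
  assumes "is_pullback C f g p q"
  shows "is_pullback C g f q p"
proof -
  have D: "Dom C q = Dom C p" using assms by (auto simp: is_pullback_def hom_iff)
  have "\<exists>!u. u \<in> hom C T (Dom C q) \<and> q \<cdot>\<^bsub>C\<^esub> u = a \<and> p \<cdot>\<^bsub>C\<^esub> u = b"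
    if "a \<in> hom C T (Dom C g)" "b \<in> hom C T (Dom C f)" "g \<cdot>\<^bsub>C\<^esub> a = f \<cdot>\<^bsub>C\<^esub> b" for T a b
  proof -
    have "\<exists>!u. u \<in> hom C T (Dom C p) \<and> p \<cdot>\<^bsub>C\<^esub> u = b \<and> q \<cdot>\<^bsub>C\<^esub> u = a"
      using assms that unfolding is_pullback_def by simp
    then show ?thesis unfolding D by (simp only: conj_commute[of "p \<cdot>\<^bsub>C\<^esub> _ = b"])
  qed
  then show ?thesis
    using assms unfolding is_pullback_def by (simp add: D)
qed

lemma internal_category_opposite:
  assumes "category E" "internal_category E X"
  shows "internal_category E (opposite X)"
proof -
  interpret internal_cat E X using assms by (simp add: internal_cat_def internal_cat_axioms_def)
  have assoc: "icomp E (opposite X) (icomp E (opposite X) f g) h =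
      icomp E (opposite X) f (icomp E (opposite X) g h)"
    if "composable E (opposite X) f g" "composable E (opposite X) g h" for f g h
  proof -
    have gf: "composable E X g f" and hg: "composable E X h g"
      using that by (simp_all add: composable_opposite)
    then have D: "Dom E f = Dom E g" "Dom E g = Dom E h" by (auto simp: composable_iff)
    show ?thesis
      using D icomp_arr(2)[OF gf] icomp_arr(2)[OF hg] icomp_assoc[OF hg gf]
      by (simp add: icomp_opposite)
  qed
  show ?thesis
    unfolding internal_category_def
  proof (intro conjI allI impI ballI)
    show "is_pullback E (d1 (opposite X)) (d0 (opposite X)) (pr1 (opposite X)) (pr2 (opposite X))"
      using pullback_commute[OF pb] by simp
  next
    fix U f assume "f \<in> hom E U (ob1 (opposite X))"
    then have f [simp]: "f \<in> Arr E" "Cod E f = ob1 X" by (auto simp: hom_iff)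
    show "icomp E (opposite X) (s0 (opposite X) \<cdot>\<^bsub>E\<^esub> (d0 (opposite X) \<cdot>\<^bsub>E\<^esub> f)) f = f"
      "icomp E (opposite X) f (s0 (opposite X) \<cdot>\<^bsub>E\<^esub> (d1 (opposite X) \<cdot>\<^bsub>E\<^esub> f)) = f"
      by (simp_all add: icomp_opposite icomp_unit)
  qed (simp_all add: hom_iff d0_mult d1_mult assoc)
qed

lemma internal_functor_opposite:
  assumes E: "category E" and X: "internal_category E X"
  shows "internal_functor E (opposite X) (opposite Y) h \<longleftrightarrow> internal_functor E X Y h"
proof -
  interpret internal_cat E X using assms by (simp add: internal_cat_def internal_cat_axioms_def)
  have "snd h \<in> hom E (ob1 X) (ob1 Y) \<Longrightarrow> icomp E (opposite Y) (snd h \<cdot>\<^bsub>E\<^esub> pr2 X) (snd h \<cdot>\<^bsub>E\<^esub> pr1 X) =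
      icomp E Y (snd h \<cdot>\<^bsub>E\<^esub> pr1 X) (snd h \<cdot>\<^bsub>E\<^esub> pr2 X)"
    by (rule icomp_opposite) (simp add: hom_iff)
  then show ?thesis by (auto simp: internal_functor_def)
qed

section \<open>Discrete fibrations and cofibrations\<close>

text \<open>Here \<open>\<sigma>\<close> is the identity for discrete fibrations and \<open>opposite\<close> for discrete cofibrations.\<close>

lemma presheaf_category_over_cat:
  fixes \<sigma> :: "('o, 'm) icat \<Rightarrow> ('o, 'm) icat"
  assumes E: "category E" "finitely_complete E" and Y: "internal_category E (\<sigma> Y)"
    and D: "\<And>A. A \<in> D \<Longrightarrow> internal_category E (fst A) \<and> internal_functor E (fst A) Y (snd A)"
    and D_difib: "\<And>A. A \<in> D \<Longrightarrow> internal_category E (\<sigma> (fst A)) \<and>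
      discrete_fibration E (\<sigma> (fst A)) (\<sigma> Y) (snd A)"
    and difib_D: "\<And>X h. internal_category E X \<Longrightarrow> discrete_fibration E X (\<sigma> Y) h \<Longrightarrow>
      \<exists>X'. \<sigma> X' = X \<and> (X', h) \<in> D"
    and ob0: "\<And>X. ob0 (\<sigma> X) = ob0 X"
    and functor_iff: "\<And>A B f. A \<in> D \<Longrightarrow> B \<in> D \<Longrightarrow>
      internal_functor E (\<sigma> (fst A)) (\<sigma> (fst B)) f \<longleftrightarrow> internal_functor E (fst A) (fst B) f"
  shows "presheaf_category E (\<sigma> Y) (over_cat E D) (\<lambda>A. ob0 (fst A)) (\<lambda>k. fst (fst (snd k)))
    (\<lambda>A. fst (snd A)) (\<lambda>A. difib_act E (\<sigma> (fst A)) (snd A))"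
proof -
  interpret Y: internal_cat E "\<sigma> Y" using E Y by (simp add: internal_cat_def internal_cat_axioms_def)
  have difib: "difib E (\<sigma> (fst A)) (\<sigma> Y) (snd A)" if "A \<in> D" for A
    using D_difib[OF that] Y E(1)
    by (simp add: difib_def difib_axioms_def internal_cat_def internal_cat_axioms_def)
  note act = difib.right_action_difib_act[OF difib]
  interpret C: category "over_cat E D" by (rule category_over_cat[OF E(1) D])
  note h_arr = internal_functor_arr[OF conjunct2[OF D]]
  let ?C = "over_cat E D"
  have Arr: "\<exists>A f B. k = (A, f, B) \<and> A \<in> D \<and> B \<in> D \<and> internal_functor E (fst A) (fst B) f \<and>
      internal_functor E (\<sigma> (fst A)) (\<sigma> (fst B)) f \<and> ifun_comp E (snd B) f = snd A"
    if "k \<in> Arr ?C" for k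
  proof -
    obtain A f B where k: "k = (A, f, B)" by (rule prod_cases3)
    then show ?thesis
      using that functor_iff[of A B f] by (intro exI[of _ A] exI[of _ f] exI[of _ B]) simp
  qed
  show ?thesis
  proof (intro presheaf_category.intro presheaf_category_axioms.intro)
    show "internal_cat E (\<sigma> Y)" "category ?C" by (rule Y.internal_cat_axioms C.category_axioms)+
    show "finitely_complete E" by fact
    show "is_functor ?C E (\<lambda>A. ob0 (fst A)) (\<lambda>k. fst (fst (snd k)))"
      unfolding is_functor_def
    proof (intro conjI ballI impI)
      show "ob0 (fst A) \<in> Obj E" if "A \<in> Obj ?C" for A
      proof -
        from that have A: "A \<in> D" by simp
        show ?thesis using Y.Dom_in_Obj[OF h_arr(1)[OF A]] by (simp only: h_arr(2)[OF A])
      qed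
      show "fst (fst (snd k)) \<in> hom E (ob0 (fst (Dom ?C k))) (ob0 (fst (Cod ?C k)))"
        if "k \<in> Arr ?C" for k
        using Arr[OF that] by (elim exE conjE) (simp add: hom_iff internal_functor_arr)
      show "fst (fst (snd (Id ?C A))) = Id E (ob0 (fst A))" for A
        by (simp add: ifun_id_def)
      show "fst (fst (snd (l \<cdot>\<^bsub>?C\<^esub> k))) = fst (fst (snd l)) \<cdot>\<^bsub>E\<^esub> fst (fst (snd k))" for k l
        by (cases k, cases l) (simp add: ifun_comp_def)
    qed
  next
    fix A assume "A \<in> Obj ?C"
    then have A: "A \<in> D" by simp
    show "right_action E (\<sigma> Y) (fst (snd A)) (difib_act E (\<sigma> (fst A)) (snd A))"
      by (rule act[OF A])
    show "Dom E (fst (snd A)) = ob0 (fst A)" by (rule h_arr(2)[OF A])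
  next
    fix k assume "k \<in> Arr ?C"
    from Arr[OF this] obtain A f B where k: "k = (A, f, B)" "ifun_comp E (snd B) f = snd A"
      by (elim exE conjE)
    have "fst (snd B) \<cdot>\<^bsub>E\<^esub> fst f = fst (snd A)"
      by (simp add: ifun_comp_def flip: k(2))
    then show "fst (snd (Cod ?C k)) \<cdot>\<^bsub>E\<^esub> fst (fst (snd k)) = fst (snd (Dom ?C k))"
      by (simp add: k(1))
  next
    fix k x f assume "k \<in> Arr ?C" and xf: "actable E (\<sigma> Y) (fst (snd (Dom ?C k))) x f"
    from Arr[OF this(1)] obtain A g B where k: "k = (A, g, B)" and AB: "A \<in> D" "B \<in> D"
      and g: "internal_functor E (\<sigma> (fst A)) (\<sigma> (fst B)) g" "ifun_comp E (snd B) g = snd A"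
      by (elim exE conjE)
    show "fst (fst (snd k)) \<cdot>\<^bsub>E\<^esub> difib_act E (\<sigma> (fst (Dom ?C k))) (snd (Dom ?C k)) x f =
        difib_act E (\<sigma> (fst (Cod ?C k))) (snd (Cod ?C k)) (fst (fst (snd k)) \<cdot>\<^bsub>E\<^esub> x) f"
      using difib_functor_equivariant[OF difib[OF AB(1)] difib[OF AB(2)] g] xf k by simp
  next
    fix k l A B assume k: "k \<in> hom ?C A B" and l: "l \<in> hom ?C A B"
      and eq: "fst (fst (snd k)) = fst (fst (snd l))"
    from k have k_arr: "k \<in> Arr ?C" "Dom ?C k = A" "Cod ?C k = B" by (auto simp: hom_iff)
    from Arr[OF k_arr(1)] k_arr(2,3) obtain f where f: "k = (A, f, B)" "B \<in> D"
      "internal_functor E (\<sigma> (fst A)) (\<sigma> (fst B)) f" "ifun_comp E (snd B) f = snd A"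
      by auto
    from l have l_arr: "l \<in> Arr ?C" "Dom ?C l = A" "Cod ?C l = B" by (auto simp: hom_iff)
    from Arr[OF l_arr(1)] l_arr(2,3) obtain g where g: "l = (A, g, B)"
      "internal_functor E (\<sigma> (fst A)) (\<sigma> (fst B)) g" "ifun_comp E (snd B) g = snd A"
      by auto
    have "f = g"
      using difib_functor_unique[OF difib[OF f(2)] f(3) g(2) f(4) g(3)] eq f(1) g(1) by simp
    then show "k = l" using f(1) g(1) by simp
  next
    fix A B u assume "A \<in> Obj ?C" "B \<in> Obj ?C" and u: "u \<in> hom E (ob0 (fst A)) (ob0 (fst B))"
      and over: "fst (snd B) \<cdot>\<^bsub>E\<^esub> u = fst (snd A)"
      and equi: "\<And>x f. actable E (\<sigma> Y) (fst (snd A)) x f \<Longrightarrow>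
        u \<cdot>\<^bsub>E\<^esub> difib_act E (\<sigma> (fst A)) (snd A) x f = difib_act E (\<sigma> (fst B)) (snd B) (u \<cdot>\<^bsub>E\<^esub> x) f"
    then have AB: "A \<in> D" "B \<in> D" by simp_all
    have u': "u \<in> hom E (ob0 (\<sigma> (fst A))) (ob0 (\<sigma> (fst B)))" using u by (simp add: ob0)
    obtain u1 where "internal_functor E (\<sigma> (fst A)) (\<sigma> (fst B)) (u, u1)"
      "ifun_comp E (snd B) (u, u1) = snd A"
      by (rule difib_functor_exists[OF difib[OF AB(1)] difib[OF AB(2)] u' over equi])
    then have "(A, (u, u1), B) \<in> hom ?C A B" using AB by (simp add: hom_iff functor_iff)
    then show "\<exists>k\<in>hom ?C A B. fst (fst (snd k)) = u" by force
  next
    fix a \<alpha> assume "right_action E (\<sigma> Y) a \<alpha>"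
    then obtain X h where X: "internal_category E X" "discrete_fibration E X (\<sigma> Y) h"
      "fst h = a" "\<And>x f. actable E (\<sigma> Y) a x f \<Longrightarrow> difib_act E X h x f = \<alpha> x f"
      by (rule right_action.realized_by_difib[OF _ E(2)]) blast
    \<comment> \<open>The category of elements is a discrete fibration over
      \<open>\<sigma> Y\<close>; \<open>difib_D\<close> finds the object of \<open>D\<close> whose
      image under \<sigma> it is.\<close>
    from difib_D[OF X(1,2)] obtain X' where "\<sigma> X' = X" "(X', h) \<in> D" by blast
    then show "\<exists>A\<in>Obj ?C. fst (snd A) = a \<and>
        (\<forall>x f. actable E (\<sigma> Y) a x f \<longrightarrow> difib_act E (\<sigma> (fst A)) (snd A) x f = \<alpha> x f)"
      using X(3,4) by (intro bexI[of _ "(X', h)"]) simp_all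
  qed
qed

theorem proposition4p10:
  fixes E :: "('o, 'm) cat" and Y :: "('o, 'm) icat"
  assumes "gumm_category E"
    and "internal_category E Y"
  shows "gumm_category (Difib E Y) \<and> gumm_category (Dicofib E Y)"
proof
  have E: "category E" "finitely_complete E" "shifting_lemma E"
    using assms(1) by (auto simp: gumm_category_def)
  note op = internal_category_opposite[OF E(1)]
  show "gumm_category (Difib E Y)"
    unfolding Difib_def
    by (rule presheaf_category.D_gumm_category[OF
          presheaf_category_over_cat[where \<sigma> = "\<lambda>X. X", OF E(1,2) assms(2)] E(3)])
      (auto simp: discrete_fibration_def)
  show "gumm_category (Dicofib E Y)"
    unfolding Dicofib_def
  proof (rule presheaf_category.D_gumm_category[OF
        presheaf_category_over_cat[where \<sigma> = opposite, OF E(1,2) op[OF assms(2)]] E(3)])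
    \<comment> \<open>The preimage required of a discrete fibration \<open>X\<close> over
      \<open>opposite Y\<close> is \<open>opposite X\<close>, a discrete cofibration over
      \<open>Y\<close> because \<open>opposite\<close> is an involution that exchanges
      \<open>d0\<close> and \<open>d1\<close>.\<close>
    fix X h assume X: "internal_category E X" "discrete_fibration E X (opposite Y) h"
    then have "discrete_cofibration E (opposite X) Y h"
      using internal_functor_opposite[OF E(1) X(1), of "opposite Y"]
      by (simp add: discrete_cofibration_def discrete_fibration_def)
    then show "\<exists>X'. opposite X' = X \<and>
        (X', h) \<in> {(X, h). internal_category E X \<and> discrete_cofibration E X Y h}"
      using op[OF X(1)] by (intro exI[of _ "opposite X"]) simp
  qed (auto simp: discrete_cofibration_def discrete_fibration_def op internal_functor_opposite[OF E(1)])
qed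

end
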